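(* Let $g_0:\mathbb{R}^n\to\overline{\mathbb{R}}$ be proper and lsc, $h:\mathbb{R}^m\to\overline{\mathbb{R}}$ proper, lsc and nondecreasing, and let $G=(g_1,\dots,g_m):\Xi\times\mathbb{R}^n\to\mathbb{R}^m$ have random lsc component functions $g_i:\Xi\times\mathbb{R}^n\to\mathbb{R}$ with $g_i(\cdot,x)$ uniformly bounded on $\Xi$, locally uniformly in $x$. Let $\mu,\mu^\nu\in\mathscr{P}(\Xi)$ with $d_{\rm TV}(\mu^\nu,\mu)\to0$, let $\alpha\ge1$, and let $\lambda^\nu\in(0,\infty)\to0$ satisfy $\tfrac1{\lambda^\nu}d_{\rm TV}(\mu^\nu,\mu)^\alpha\to0$. Define $\phi(x)=g_0(x)+h(\mathbb{E}_\mu[G(\boldsymbol\xi,x)])$, $f(u,x)=g_0(x)+h(u+\mathbb{E}_\mu[G(\boldsymbol\xi,x)])+\iota_{\{0\}^m}(u)$ and $f^\nu(u,x)=g_0(x)+h(u+\mathbb{E}_{\mu^\nu}[G(\boldsymbol\xi,x)])+\tfrac1{\alpha\lambda^\nu}\|u\|_2^\alpha$, and suppose $\operatorname{argmin}\phi\ne\emptyset$. Then $f^\nu$ epi-converge to $f$, and: (a) $\inf f=\inf\phi$ and $\epsilon\text{-}\operatorname{argmin}f=\{0\}\times\epsilon\text{-}\operatorname{argmin}\phi$ for every $\epsilon\in[0,\infty)$; (b) $\limsup_\nu(\inf f^\nu)\le\inf f$; (c) if $\epsilon^\nu\in[0,\infty)\to\epsilon\in[0,\infty)$, then $\operatorname{LimOut}(\epsilon^\nu\text{-}\operatorname{argmin}f^\nu)\subseteq\epsilon\text{-}\operatorname{argmin}f$;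 (d) if $\epsilon^\nu\in[0,\infty)\to0$ and, for some infinite $N\subseteq\mathbb{N}$, points $(u^\nu,x^\nu)\in\epsilon^\nu\text{-}\operatorname{argmin}f^\nu$, $\nu\in N$, converge along $N$, then $\lim_{\nu\in N}(\inf f^\nu)=\inf f$; (e) $\inf f^\nu\to\inf f$ if and only if the functions $f^\nu$ are tight; (f) if $\inf f^\nu\to\inf f$, then for every $x_0\in\operatorname{argmin}\phi$ there exist $\epsilon^\nu\in[0,\infty)\to0$ with $(0,x_0)\in\operatorname{LimInn}(\epsilon^\nu\text{-}\operatorname{argmin}f^\nu)$; (g) if $\inf f^\nu\to\inf f$, then there exist $\epsilon^\nu\in[0,\infty)\to0$ such that $\operatorname{Lim}(\epsilon^\nu\text{-}\operatorname{argmin}f^\nu)=\operatorname{argmin}f$.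
   Context: $\Xi\subseteq\mathbb{R}^d$ is nonempty and closed; $\mathscr{P}(\Xi)$ is the set of Borel probability measures on $\Xi$; $\overline{\mathbb{R}}=[-\infty,\infty]$; lsc = lower semicontinuous; proper = never $-\infty$ and not identically $\infty$; $h$ nondecreasing means $h(y)\ge h(z)$ whenever $y\ge z$ componentwise. $\iota_C=0$ on $C$, $\infty$ off $C$. $g:\Xi\times\mathbb{R}^n\to\overline{\mathbb{R}}$ is random lsc if $\xi\mapsto\operatorname{epi}g(\xi,\cdot)=\{(x,t):g(\xi,x)\le t\}$ is closed-valued and measurable (i.e. $\{\xi:\operatorname{epi}g(\xi,\cdot)\cap O\ne\emptyset\}$ is Borel for every open $O\subseteq\mathbb{R}^{n+1}$). "$g_i(\cdot,x)$ uniformly bounded on $\Xi$, locally uniformly in $x$" means: for every $x\in\mathbb{R}^n$ there are $\epsilon_x>0$, $M_x<\infty$ with $|g_i(\xi,y)|\le M_x$ for all $\xi\in\Xi$ and $\|y-x\|_2\le\epsilon_x$. Total variation: $d_{\rm TV}(\mu_1,\mu_2)=\sup\{\int_\Xi\ell\,d(\mu_1-\mu_2): \ell:\Xi\to[-1,1]\text{ measurable}\}$. For $\psi:\mathbb{R}^k\to\overline{\mathbb{R}}$: $\operatorname{dom}\psi=\{\psi<\infty\}$, $\operatorname{argmin}\psi=\{z\in\operatorname{dom}\psi:\psi(z)=\inf\psi\}$, $\epsilon\text{-}\operatorname{argmin}\psi=\{z\in\operatorname{dom}\psi:\psi(z)\le\inf\psi+\epsilon\}$. For sets $C^\nu\subseteq\mathbb{R}^k$: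 $\operatorname{LimOut}C^\nu$ is the set of limits of sequences $z^\nu\in C^\nu$, $\nu\in N$, over infinite $N\subseteq\mathbb{N}$; $\operatorname{LimInn}C^\nu$ is the set of limits of sequences $z^\nu\in C^\nu$, $\nu\in\mathbb{N}$; $\operatorname{Lim}C^\nu=C$ means both equal $C$. $\psi^\nu$ epi-converge to $\psi$ if for every $z$: $\liminf\psi^\nu(z^\nu)\ge\psi(z)$ for all $z^\nu\to z$ and $\limsup\psi^\nu(z^\nu)\le\psi(z)$ for some $z^\nu\to z$. The $\psi^\nu$ are tight if for every $\epsilon>0$ there are a compact $S_\epsilon$ and $\nu_\epsilon$ with $\inf_{S_\epsilon}\psi^\nu\le\inf\psi^\nu+\epsilon$ for all $\nu\ge\nu_\epsilon$.
   Formalization: In LimInn (hence in Lim) z^ν∈C^ν is required only for all sufficiently large ν; with every ν, (f) and (g) fail if some inf f^ν=-∞, e.g. g_0=0, G=0, h(y)=y, α=1, λ^0=2, μ^ν=μ, where ε-argmin f^0 is empty. *)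

theory Defs
  imports "HOL-Probability.Probability"
begin

subsection \<open>Extended-real-valued functions\<close>

definition proper_fun :: "('a \<Rightarrow> ereal) \<Rightarrow> bool" where
  "proper_fun \<psi> \<longleftrightarrow> (\<forall>z. \<psi> z \<noteq> -\<infinity>) \<and> (\<exists>z. \<psi> z \<noteq> \<infinity>)"

definition lsc_fun :: "('a::topological_space \<Rightarrow> ereal) \<Rightarrow> bool" where
  "lsc_fun \<psi> \<longleftrightarrow> (\<forall>z. \<psi> z \<le> Liminf (at z) \<psi>)"

definition dom_fun :: "('a \<Rightarrow> ereal) \<Rightarrow> 'a set" where
  "dom_fun \<psi> = {z. \<psi> z < \<infinity>}"

definition argmin_set :: "('a \<Rightarrow> ereal) \<Rightarrow> 'a set" where
  "argmin_set \<psi> = {z \<in> dom_fun \<psi>. \<psi> z = (INF w. \<psi> w)}"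

definition eps_argmin :: "real \<Rightarrow> ('a \<Rightarrow> ereal) \<Rightarrow> 'a set" where
  "eps_argmin \<epsilon> \<psi> = {z \<in> dom_fun \<psi>. \<psi> z \<le> (INF w. \<psi> w) + ereal \<epsilon>}"

text \<open>The indicator function of convex analysis: 0 on the set and infinity off it.\<close>

definition iota :: "'a set \<Rightarrow> 'a \<Rightarrow> ereal" where
  "iota C z = (if z \<in> C then 0 else \<infinity>)"

text \<open>The epigraph lives in the product with the reals, so it contains no points at infinite height.\<close>

definition epi :: "('a \<Rightarrow> ereal) \<Rightarrow> ('a \<times> real) set" where
  "epi \<psi> = {(z, t). \<psi> z \<le> ereal t}"

definition random_lsc ::
    "'d::topological_space set \<Rightarrow> ('d \<Rightarrow> 'a::topological_space \<Rightarrow> ereal) \<Rightarrow> bool" where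
  "random_lsc \<Xi> g \<longleftrightarrow>
     (\<forall>\<xi>\<in>\<Xi>. closed (epi (g \<xi>))) \<and>
     (\<forall>U. open U \<longrightarrow> {\<xi>\<in>\<Xi>. epi (g \<xi>) \<inter> U \<noteq> {}} \<in> sets (restrict_space borel \<Xi>))"

definition unif_bounded_locally ::
    "'d set \<Rightarrow> ('d \<Rightarrow> 'a::real_normed_vector \<Rightarrow> real) \<Rightarrow> bool" where
  "unif_bounded_locally \<Xi> g \<longleftrightarrow>
     (\<forall>x. \<exists>\<epsilon>>0. \<exists>M. \<forall>\<xi>\<in>\<Xi>. \<forall>y. norm (y - x) \<le> \<epsilon> \<longrightarrow> \<bar>g \<xi> y\<bar> \<le> M)"

subsection \<open>Probability measures and total variation\<close>

definition prob_measures_on :: "'d::topological_space set \<Rightarrow> 'd measure set" where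
  "prob_measures_on \<Xi> = {\<mu>. prob_space \<mu> \<and> sets \<mu> = sets (restrict_space borel \<Xi>)}"

text \<open>The test functions take values in [-1,1], so for probability measures the supremum is over a
  nonempty set bounded by 2.\<close>

definition tv_dist ::
    "'d::topological_space set \<Rightarrow> 'd measure \<Rightarrow> 'd measure \<Rightarrow> real" where
  "tv_dist \<Xi> \<mu>1 \<mu>2 =
     (SUP l \<in> {l \<in> borel_measurable (restrict_space borel \<Xi>). \<forall>\<xi>\<in>\<Xi>. l \<xi> \<in> {-1..1}}.
        (LINT \<xi>|\<mu>1. l \<xi>) - (LINT \<xi>|\<mu>2. l \<xi>))"

subsection \<open>Set limits, epi-convergence, tightness\<close>

text \<open>Limits along the indices in an infinite set \<open>N\<close>.\<close>

abbreviation along :: "nat set \<Rightarrow> nat filter" where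
  "along N \<equiv> inf sequentially (principal N)"

definition LimOut :: "(nat \<Rightarrow> 'a::topological_space set) \<Rightarrow> 'a set" where
  "LimOut C = {z. \<exists>N y. infinite N \<and> (\<forall>\<nu>\<in>N. y \<nu> \<in> C \<nu>) \<and> (y \<longlongrightarrow> z) (along N)}"

text \<open>As usual for Painleve-Kuratowski inner limits, finitely many of the sets may be empty:
  membership is required for all sufficiently large indices.\<close>

definition LimInn :: "(nat \<Rightarrow> 'a::topological_space set) \<Rightarrow> 'a set" where
  "LimInn C = {z. \<exists>y. (\<forall>\<^sub>F \<nu> in sequentially. y \<nu> \<in> C \<nu>) \<and> y \<longlonglongrightarrow> z}"

definition set_lim :: "(nat \<Rightarrow> 'a::topological_space set) \<Rightarrow> 'a set \<Rightarrow> bool" where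
  "set_lim C D \<longleftrightarrow> LimOut C = D \<and> LimInn C = D"

definition epi_converges ::
    "(nat \<Rightarrow> 'a::topological_space \<Rightarrow> ereal) \<Rightarrow> ('a \<Rightarrow> ereal) \<Rightarrow> bool" where
  "epi_converges \<psi>s \<psi> \<longleftrightarrow>
     (\<forall>z. (\<forall>y. y \<longlonglongrightarrow> z \<longrightarrow> liminf (\<lambda>\<nu>. \<psi>s \<nu> (y \<nu>)) \<ge> \<psi> z) \<and>
          (\<exists>y. y \<longlonglongrightarrow> z \<and> limsup (\<lambda>\<nu>. \<psi>s \<nu> (y \<nu>)) \<le> \<psi> z))"

definition tight_funs :: "(nat \<Rightarrow> 'a::topological_space \<Rightarrow> ereal) \<Rightarrow> bool" where
  "tight_funs \<psi>s \<longleftrightarrow>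
     (\<forall>\<epsilon>>0::real. \<exists>S \<nu>0. compact S \<and>
        (\<forall>\<nu>\<ge>\<nu>0. (INF z\<in>S. \<psi>s \<nu> z) \<le> (INF z. \<psi>s \<nu> z) + ereal \<epsilon>))"

end

theory Submission
  imports Defs
begin

text \<open>Epi-convergence, lower bound: lower semicontinuity of \<open>x \<mapsto> \<integral>G(\<xi>,x) d\<mu>\<close> (Fatou) and the total
  variation bound, uniform near \<open>x\<close>, give a componentwise lower limit of the perturbed
  expectations, which \<open>h\<close> preserves since it is nondecreasing and lsc, while the penalty blows up
  unless \<open>u = 0\<close>. Upper bound: a recovery sequence at \<open>(0, x)\<close> corrects the expectation exactly by
  \<open>u = \<integral>G(\<xi>,x) d\<mu> - \<integral>G(\<xi>,x) d(\<mu>s \<nu>)\<close>, whose norm is of the order of the total variation distance,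
  so that its penalty vanishes by the rate assumption.

  The remaining claims hold for every epi-convergent sequence whose limit attains a finite infimum.
  For the last one, recovery sequences for a countable dense set of minimizers give countably many
  null sequences of tolerances, and one null sequence eventually dominates each of them.\<close>

subsection \<open>Consequences of epi-convergence\<close>

lemma along_neq_bot: "infinite N \<Longrightarrow> along N \<noteq> bot"
  unfolding trivial_limit_def eventually_inf_principal
  by (metis (mono_tags, lifting) eventually_sequentially infinite_nat_iff_unbounded_le)

text \<open>Compactness delivers subsequences as compositions, whereas outer limits and the lower
  epi-bound are stated along index sets. As \<open>r\<close> is strictly monotone,
  \<open>r K \<le> r k\<close> forces \<open>K \<le> k\<close>, so tails of the two kinds
  correspond.\<close>

lemma tendsto_along_range:
  fixes y :: "nat \<Rightarrow> 'a::topological_space"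
  assumes r: "strict_mono (r :: nat \<Rightarrow> nat)" and y: "(y \<circ> r) \<longlonglongrightarrow> z"
  shows "(y \<longlongrightarrow> z) (along (range r))"
proof (rule topological_tendstoI)
  fix U assume "open U" "z \<in> U"
  with y have "\<forall>\<^sub>F k in sequentially. y (r k) \<in> U"
    by (auto dest: topological_tendstoD)
  then obtain K where K: "\<And>k. k \<ge> K \<Longrightarrow> y (r k) \<in> U"
    unfolding eventually_sequentially by blast
  have "y \<nu> \<in> U" if "\<nu> \<ge> r K" "\<nu> \<in> range r" for \<nu>
    using that K strict_mono_less_eq[OF r] by auto
  then show "\<forall>\<^sub>F \<nu> in along (range r). y \<nu> \<in> U"
    unfolding eventually_inf_principal eventually_sequentially by blast
qed

text \<open>Epi-convergence speaks about full sequences only. Filling the indices outside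
  \<open>N\<close> with the constant \<open>z\<close> yields a full sequence that still tends to
  \<open>z\<close>, and its lower bound restricts back to \<open>N\<close>.\<close>

lemma epi_converges_less_along:
  fixes z :: "'a::topological_space"
  assumes "epi_converges \<psi>s \<psi>" "(y \<longlongrightarrow> z) (along N)" "c < \<psi> z"
  shows "\<forall>\<^sub>F \<nu> in along N. c < \<psi>s \<nu> (y \<nu>)"
proof -
  define w where "w = (\<lambda>\<nu>. if \<nu> \<in> N then y \<nu> else z)"
  have "w \<longlonglongrightarrow> z"
  proof (rule topological_tendstoI)
    fix U assume U: "open U" "z \<in> U"
    from topological_tendstoD[OF assms(2) U] show "\<forall>\<^sub>F \<nu> in sequentially. w \<nu> \<in> U"
      unfolding eventually_inf_principal by eventually_elim (auto simp: w_def U)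
  qed
  with assms(1) have "\<psi> z \<le> liminf (\<lambda>\<nu>. \<psi>s \<nu> (w \<nu>))"
    unfolding epi_converges_def by blast
  with assms(3) have "\<forall>\<^sub>F \<nu> in sequentially. c < \<psi>s \<nu> (w \<nu>)"
    unfolding le_Liminf_iff by blast
  then show ?thesis
    unfolding eventually_inf_principal by eventually_elim (auto simp: w_def)
qed

section \<open>Infima and near-minimizers of epi-convergent sequences\<close>

lemma epi_converges_recovery:
  assumes "epi_converges \<psi>s \<psi>"
  obtains y where "y \<longlonglongrightarrow> z" and "\<And>c. \<psi> z < c \<Longrightarrow> \<forall>\<^sub>F \<nu> in sequentially. \<psi>s \<nu> (y \<nu>) < c"
  using assms unfolding epi_converges_def Limsup_le_iff by metis

text \<open>Some point has a limit value below \<open>c\<close>, and the values along its recovery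
  sequence bound the infima from above.\<close>

lemma epi_converges_INF_less:
  assumes "epi_converges \<psi>s \<psi>" "(INF z. \<psi> z) < c"
  shows "\<forall>\<^sub>F \<nu> in sequentially. (INF z. \<psi>s \<nu> z) < c"
proof -
  obtain z where "\<psi> z < c"
    using assms(2) by (auto simp: INF_less_iff)
  then obtain y where "\<forall>\<^sub>F \<nu> in sequentially. \<psi>s \<nu> (y \<nu>) < c"
    using epi_converges_recovery[OF assms(1)] by metis
  then show ?thesis
    by eventually_elim (auto simp: INF_less_iff)
qed

lemma epi_converges_limsup_INF:
  assumes "epi_converges \<psi>s \<psi>"
  shows "limsup (\<lambda>\<nu>. INF z. \<psi>s \<nu> z) \<le> (INF z. \<psi> z)"
  unfolding Limsup_le_iff using epi_converges_INF_less[OF assms] by blast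

text \<open>If the cluster point were too expensive, the lower epi-bound would keep the values at
  the near-minimizers above a level \<open>c\<close>, while the upper bound on the infima plus the
  tolerances pushes them below it.\<close>

lemma epi_converges_LimOut_eps_argmin:
  fixes \<psi> :: "'a::topological_space \<Rightarrow> ereal"
  assumes epi: "epi_converges \<psi>s \<psi>" and fin: "(INF z. \<psi> z) < \<infinity>" and \<epsilon>: "\<epsilon>s \<longlonglongrightarrow> \<epsilon>"
  shows "LimOut (\<lambda>\<nu>. eps_argmin (\<epsilon>s \<nu>) (\<psi>s \<nu>)) \<subseteq> eps_argmin \<epsilon> \<psi>"
proof
  fix z assume "z \<in> LimOut (\<lambda>\<nu>. eps_argmin (\<epsilon>s \<nu>) (\<psi>s \<nu>))"
  then obtain N y where N: "infinite N" and y: "\<And>\<nu>. \<nu> \<in> N \<Longrightarrow> y \<nu> \<in> eps_argmin (\<epsilon>s \<nu>) (\<psi>s \<nu>)"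
    and lim: "(y \<longlongrightarrow> z) (along N)"
    unfolding LimOut_def by blast
  have le: "\<psi> z \<le> (INF w. \<psi> w) + ereal \<epsilon>"
  proof (rule ccontr)
    assume "\<not> ?thesis"
    then obtain c where c: "(INF w. \<psi> w) + ereal \<epsilon> < ereal c" "ereal c < \<psi> z"
      using ereal_dense2 by (metis not_le)
    \<comment> \<open>Real gap between the levels: the infima eventually stay below
      \<open>d\<close>, and the tolerances, tending to \<open>\<epsilon> < c - d\<close>, eventually
      stay below \<open>c - d\<close>.\<close>
    then have "(INF w. \<psi> w) < ereal (c - \<epsilon>)"
      by (cases "INF w. \<psi> w") auto
    then obtain d where d: "(INF w. \<psi> w) < ereal d" "d < c - \<epsilon>"
      using ereal_dense2 by (metis ereal_less(2) less_ereal.simps(1))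
    have "\<forall>\<^sub>F \<nu> in along N. c < \<psi>s \<nu> (y \<nu>)"
      using epi_converges_less_along[OF epi lim] c(2) by blast
    moreover have "\<forall>\<^sub>F \<nu> in along N. (INF w. \<psi>s \<nu> w) < ereal d"
      using epi_converges_INF_less[OF epi d(1)] unfolding eventually_inf_principal
      by eventually_elim auto
    moreover have "\<forall>\<^sub>F \<nu> in sequentially. \<epsilon>s \<nu> < c - d"
      by (rule order_tendstoD(2)[OF \<epsilon>]) (use d(2) in simp)
    then have "\<forall>\<^sub>F \<nu> in along N. \<epsilon>s \<nu> < c - d"
      unfolding eventually_inf_principal by eventually_elim auto
    moreover have "\<forall>\<^sub>F \<nu> in along N. \<nu> \<in> N"
      by (simp add: eventually_inf_principal)
    ultimately have "\<forall>\<^sub>F \<nu> in along N. False"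
    proof eventually_elim
      case (elim \<nu>)
      have "\<psi>s \<nu> (y \<nu>) \<le> (INF w. \<psi>s \<nu> w) + ereal (\<epsilon>s \<nu>)"
        using y[OF elim(4)] by (simp add: eps_argmin_def)
      also have "\<dots> \<le> ereal d + ereal (c - d)"
        by (intro add_mono) (use elim in auto)
      finally show False using elim(1) by simp
    qed
    then show False
      using along_neq_bot[OF N] by (simp add: trivial_limit_def)
  qed
  moreover have "\<psi> z < \<infinity>"
    using le fin by (cases "INF w. \<psi> w") auto
  ultimately show "z \<in> eps_argmin \<epsilon> \<psi>"
    by (simp add: eps_argmin_def dom_fun_def)
qed

text \<open>Only the lower bound needs the near-minimizers: each infimum is at most
  \<open>\<epsilon>s \<nu>\<close> below the value at \<open>y \<nu>\<close>, and these values are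
  eventually above any level below \<open>\<psi> z\<close>.\<close>

lemma epi_converges_INF_tendsto_along:
  fixes \<psi> :: "'a::topological_space \<Rightarrow> ereal"
  assumes epi: "epi_converges \<psi>s \<psi>" and \<epsilon>: "\<epsilon>s \<longlonglongrightarrow> 0"
    and y: "\<And>\<nu>. \<nu> \<in> N \<Longrightarrow> y \<nu> \<in> eps_argmin (\<epsilon>s \<nu>) (\<psi>s \<nu>)"
    and lim: "(y \<longlongrightarrow> z) (along N)"
  shows "((\<lambda>\<nu>. INF z. \<psi>s \<nu> z) \<longlongrightarrow> (INF z. \<psi> z)) (along N)"
proof (rule order_tendstoI)
  fix c assume "(INF z. \<psi> z) < c"
  from epi_converges_INF_less[OF epi this] show "\<forall>\<^sub>F \<nu> in along N. (INF z. \<psi>s \<nu> z) < c"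
    unfolding eventually_inf_principal by eventually_elim auto
next
  fix c assume "c < (INF z. \<psi> z)"
  also have "\<dots> \<le> \<psi> z" by (rule INF_lower) simp
  finally obtain a where a: "c < ereal a" "ereal a < \<psi> z" 
    using ereal_dense2 by blast
  \<comment> \<open>The slack \<open>a - b\<close> absorbs the tolerances.\<close>
  then obtain b where b: "c < ereal b" "b < a"
    using ereal_dense2 by (metis ereal_less(2) less_ereal.simps(1))
  have "\<forall>\<^sub>F \<nu> in along N. a < \<psi>s \<nu> (y \<nu>)"
    using epi_converges_less_along[OF epi lim a(2)] .
  moreover have "\<forall>\<^sub>F \<nu> in sequentially. \<epsilon>s \<nu> < a - b"
    using order_tendstoD(2)[OF \<epsilon>] b(2) by simp
  then have "\<forall>\<^sub>F \<nu> in along N. \<epsilon>s \<nu> < a - b \<and> \<nu> \<in> N"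
    unfolding eventually_inf_principal by eventually_elim auto
  ultimately show "\<forall>\<^sub>F \<nu> in along N. c < (INF z. \<psi>s \<nu> z)"
  proof eventually_elim
    case (elim \<nu>)
    have "ereal a < (INF w. \<psi>s \<nu> w) + ereal (\<epsilon>s \<nu>)"
      using y[of \<nu>] elim by (auto simp: eps_argmin_def)
    then have "ereal b < (INF w. \<psi>s \<nu> w)"
      using elim(2) by (cases "INF w. \<psi>s \<nu> w") auto
    with b(1) show ?case by order
  qed
qed

section \<open>Tightness and convergence of infima\<close>

text \<open>If the infima fell to a level \<open>c\<close> below the limit infimum infinitely often,
  tightness would place cheap points in one compact set; they would cluster at some
  \<open>l\<close>, where the lower epi-bound forbids cheap values.\<close>

lemma epi_converges_tight_imp_INF_tendsto:
  fixes \<psi> :: "'a::metric_space \<Rightarrow> ereal"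
  assumes epi: "epi_converges \<psi>s \<psi>" and tight: "tight_funs \<psi>s"
  shows "(\<lambda>\<nu>. INF z. \<psi>s \<nu> z) \<longlonglongrightarrow> (INF z. \<psi> z)"
proof (rule order_tendstoI)
  show "\<forall>\<^sub>F \<nu> in sequentially. (INF z. \<psi>s \<nu> z) < c" if "(INF z. \<psi> z) < c" for c
    using epi_converges_INF_less[OF epi that] .
next
  fix c assume "c < (INF z. \<psi> z)"
  then obtain a where a: "c < ereal a" "ereal a < (INF z. \<psi> z)"
    using ereal_dense2 by blast
  then obtain b where b: "c < ereal b" "b < a"
    using ereal_dense2 by (metis ereal_less(2) less_ereal.simps(1))
  \<comment> \<open>With tolerance \<open>a - b\<close>, an infimum of at most \<open>c < b\<close>
    produces a point of \<open>S\<close> with value below \<open>a\<close>.\<close>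
  obtain S \<nu>0 where S: "compact S"
    and INF_S: "\<And>\<nu>. \<nu> \<ge> \<nu>0 \<Longrightarrow> (INF z\<in>S. \<psi>s \<nu> z) \<le> (INF z. \<psi>s \<nu> z) + ereal (a - b)"
    using tight b(2) unfolding tight_funs_def by (metis diff_gt_0_iff_gt)
  show "\<forall>\<^sub>F \<nu> in sequentially. c < (INF z. \<psi>s \<nu> z)"
  proof (rule ccontr)
    assume not_ev: "\<not> ?thesis"
    define N where "N = {\<nu>. \<nu>0 \<le> \<nu> \<and> (INF z. \<psi>s \<nu> z) \<le> c}"
    have "infinite N"
      unfolding infinite_nat_iff_unbounded_le
    proof
      fix m
      show "\<exists>n\<ge>m. n \<in> N"
        using not_ev unfolding eventually_sequentially N_def
        by (metis (mono_tags, lifting) max.boundedE mem_Collect_eq not_le)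
    qed
    then obtain r :: "nat \<Rightarrow> nat" where r: "strict_mono r" "\<And>k. r k \<in> N"
      using infinite_enumerate by blast
    have "\<exists>w\<in>S. \<psi>s \<nu> w < ereal a" if "\<nu> \<in> N" for \<nu>
    proof -
      have "(INF z\<in>S. \<psi>s \<nu> z) \<le> (INF z. \<psi>s \<nu> z) + ereal (a - b)"
        using that INF_S by (simp add: N_def)
      also have "\<dots> \<le> c + ereal (a - b)"
        using that by (intro add_mono) (auto simp: N_def)
      also have "\<dots> < ereal a"
        using b by (cases c) auto
      finally show ?thesis by (simp add: INF_less_iff)
    qed
    then obtain y where y: "\<And>\<nu>. \<nu> \<in> N \<Longrightarrow> y \<nu> \<in> S \<and> \<psi>s \<nu> (y \<nu>) < ereal a"
      by metis
    with r(2) have "\<forall>k. (y \<circ> r) k \<in> S" by auto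
    then obtain l s where s: "strict_mono (s :: nat \<Rightarrow> nat)" "((y \<circ> r) \<circ> s) \<longlonglongrightarrow> l"
      using S unfolding compact_eq_seq_compact_metric seq_compact_def by metis
    have rs: "strict_mono (r \<circ> s)" using r(1) s(1) by (rule strict_mono_o)
    have lim: "(y \<longlongrightarrow> l) (along (range (r \<circ> s)))"
      using tendsto_along_range[OF rs] s(2) by (simp add: comp_assoc)
    have "ereal a < \<psi> l"
      using a(2) by (rule less_INF_D) simp
    \<comment> \<open>Every index in the range of \<open>r \<circ> s\<close> lies in
      \<open>N\<close>, where \<open>y\<close> takes values below \<open>a\<close>; hence the lower
      bound leaves no such index far out.\<close>
    from epi_converges_less_along[OF epi lim this]
    have "\<forall>\<^sub>F \<nu> in along (range (r \<circ> s)). False"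
      unfolding eventually_inf_principal
    proof eventually_elim
      case (elim \<nu>)
      have "\<nu> \<notin> range (r \<circ> s)"
        using elim y r(2) by (metis comp_apply less_asym rangeE)
      then show ?case by simp
    qed
    moreover have "infinite (range (r \<circ> s))"
      using rs by (intro range_inj_infinite strict_mono_imp_inj_on)
    ultimately show False
      using along_neq_bot by (auto simp: trivial_limit_def)
  qed
qed

text \<open>A recovery sequence of a minimizer together with its limit is compact, and its values
  are eventually near the infima because both tend to the minimum. Half of \<open>\<epsilon>\<close>
  pays for the values lying above \<open>m\<close>, half for the infima lying below it.\<close>

lemma epi_converges_INF_tendsto_imp_tight:
  fixes \<psi> :: "'a::heine_borel \<Rightarrow> ereal"
  assumes epi: "epi_converges \<psi>s \<psi>" and fin: "\<bar>INF z. \<psi> z\<bar> \<noteq> \<infinity>"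
    and z0: "z0 \<in> argmin_set \<psi>"
    and lim: "(\<lambda>\<nu>. INF z. \<psi>s \<nu> z) \<longlonglongrightarrow> (INF z. \<psi> z)"
  shows "tight_funs \<psi>s"
  unfolding tight_funs_def
proof (intro allI impI)
  fix \<epsilon> :: real assume \<epsilon>: "0 < \<epsilon>"
  obtain m where m: "(INF z. \<psi> z) = ereal m"
    using fin by (cases "INF z. \<psi> z") auto
  then have "\<psi> z0 = ereal m"
    using z0 by (simp add: argmin_set_def)
  then obtain y where y: "y \<longlonglongrightarrow> z0" "\<forall>\<^sub>F \<nu> in sequentially. \<psi>s \<nu> (y \<nu>) < ereal (m + \<epsilon> / 2)"
    using epi_converges_recovery[OF epi, of z0] \<epsilon>
    by (metis add.right_neutral add_strict_left_mono half_gt_zero less_ereal.simps(1))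
  have "\<forall>\<^sub>F \<nu> in sequentially. ereal (m - \<epsilon> / 2) < (INF z. \<psi>s \<nu> z)"
    using order_tendstoD(1)[OF lim] \<epsilon> by (simp add: m)
  with y(2) have "\<forall>\<^sub>F \<nu> in sequentially.
      (INF z\<in>insert z0 (range y). \<psi>s \<nu> z) \<le> (INF z. \<psi>s \<nu> z) + ereal \<epsilon>"
  proof eventually_elim
    case (elim \<nu>)
    have "(INF z\<in>insert z0 (range y). \<psi>s \<nu> z) \<le> \<psi>s \<nu> (y \<nu>)"
      by (rule INF_lower) simp
    also have "\<dots> \<le> ereal (m - \<epsilon> / 2) + ereal \<epsilon>"
      using less_imp_le[OF elim(1)] by (simp add: algebra_simps)
    also have "\<dots> \<le> (INF z. \<psi>s \<nu> z) + ereal \<epsilon>"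
      using elim(2) by (intro add_mono) auto
    finally show ?case .
  qed
  then show "\<exists>S \<nu>0. compact S \<and> (\<forall>\<nu>\<ge>\<nu>0. (INF z\<in>S. \<psi>s \<nu> z) \<le> (INF z. \<psi>s \<nu> z) + ereal \<epsilon>)"
    using compact_sequence_with_limit[OF y(1)] unfolding eventually_sequentially by blast
qed

section \<open>Inner limits of near-minimizers\<close>

text \<open>The tolerances are the optimality gaps of a recovery sequence at \<open>z0\<close>; they
  vanish because values and infima share the finite limit \<open>m\<close>.\<close>

lemma epi_converges_argmin_LimInn:
  fixes \<psi> :: "'a::topological_space \<Rightarrow> ereal"
  assumes epi: "epi_converges \<psi>s \<psi>" and fin: "\<bar>INF z. \<psi> z\<bar> \<noteq> \<infinity>"
    and lim: "(\<lambda>\<nu>. INF z. \<psi>s \<nu> z) \<longlonglongrightarrow> (INF z. \<psi> z)"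
    and z0: "z0 \<in> argmin_set \<psi>"
  shows "\<exists>\<epsilon>s. (\<forall>\<nu>. 0 \<le> \<epsilon>s \<nu>) \<and> \<epsilon>s \<longlonglongrightarrow> 0 \<and> z0 \<in> LimInn (\<lambda>\<nu>. eps_argmin (\<epsilon>s \<nu>) (\<psi>s \<nu>))"
proof -
  obtain m where m: "(INF z. \<psi> z) = ereal m"
    using fin by (cases "INF z. \<psi> z") auto
  then have \<psi>z0: "\<psi> z0 = ereal m"
    using z0 by (simp add: argmin_set_def)
  obtain y where y: "y \<longlonglongrightarrow> z0" and rec: "\<And>c. \<psi> z0 < c \<Longrightarrow> \<forall>\<^sub>F \<nu> in sequentially. \<psi>s \<nu> (y \<nu>) < c"
    using epi_converges_recovery[OF epi] by metis
  let ?I = "\<lambda>\<nu>. INF z. \<psi>s \<nu> z"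
  \<comment> \<open>\<open>real_of_ereal\<close> sends an infinite gap to 0. This concerns finitely
    many indices at most, since both values are eventually finite.\<close>
  define \<epsilon>s where "\<epsilon>s \<nu> = real_of_ereal (\<psi>s \<nu> (y \<nu>) - ?I \<nu>)" for \<nu>
  have le: "?I \<nu> \<le> \<psi>s \<nu> (y \<nu>)" for \<nu>
    by (rule INF_lower) simp
  have *: "\<forall>\<^sub>F \<nu> in sequentially. y \<nu> \<in> eps_argmin (\<epsilon>s \<nu>) (\<psi>s \<nu>) \<and> \<epsilon>s \<nu> < e" if "e > 0" for e
  proof -
    have "\<forall>\<^sub>F \<nu> in sequentially. \<psi>s \<nu> (y \<nu>) < ereal (m + e / 2)"
      using rec that \<psi>z0 by simp
    moreover have "\<forall>\<^sub>F \<nu> in sequentially. ereal (m - e / 2) < ?I \<nu>"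
      using order_tendstoD(1)[OF lim] that by (simp add: m)
    ultimately show ?thesis
    proof eventually_elim
      case (elim \<nu>)
      then obtain a b where "\<psi>s \<nu> (y \<nu>) = ereal a" "?I \<nu> = ereal b"
        using le[of \<nu>] by (cases "\<psi>s \<nu> (y \<nu>)"; cases "?I \<nu>") auto
      with elim show ?case
        by (simp add: \<epsilon>s_def eps_argmin_def dom_fun_def)
    qed
  qed
  have nonneg: "0 \<le> \<epsilon>s \<nu>" for \<nu>
    using le[of \<nu>] unfolding \<epsilon>s_def
    by (cases "\<psi>s \<nu> (y \<nu>)"; cases "?I \<nu>") auto
  have "\<epsilon>s \<longlonglongrightarrow> 0"
  proof (rule order_tendstoI)
    show "\<forall>\<^sub>F \<nu> in sequentially. e < \<epsilon>s \<nu>" if "e < 0" for e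
      using that nonneg by (auto intro: always_eventually less_le_trans)
    show "\<forall>\<^sub>F \<nu> in sequentially. \<epsilon>s \<nu> < e" if "0 < e" for e
      using *[OF that] by eventually_elim auto
  qed
  moreover have "z0 \<in> LimInn (\<lambda>\<nu>. eps_argmin (\<epsilon>s \<nu>) (\<psi>s \<nu>))"
    unfolding LimInn_def using y *[of 1] by (auto elim!: eventually_mono)
  ultimately show ?thesis
    using nonneg by blast
qed

text \<open>A form free of the choice of a sequence, from which closedness follows. For the
  converse, nearly nearest points of \<open>C \<nu>\<close> serve for all \<open>e\<close> at
  once.\<close>

lemma LimInn_iff:
  fixes z :: "'a::metric_space"
  shows "z \<in> LimInn C \<longleftrightarrow> (\<forall>e>0. \<forall>\<^sub>F \<nu> in sequentially. \<exists>y\<in>C \<nu>. dist y z < e)"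
proof
  assume "z \<in> LimInn C"
  then obtain y where y: "\<forall>\<^sub>F \<nu> in sequentially. y \<nu> \<in> C \<nu>" "y \<longlonglongrightarrow> z"
    unfolding LimInn_def by blast
  show "\<forall>e>0. \<forall>\<^sub>F \<nu> in sequentially. \<exists>y\<in>C \<nu>. dist y z < e"
  proof (intro allI impI)
    fix e :: real assume "e > 0"
    from tendstoD[OF y(2) this] y(1) show "\<forall>\<^sub>F \<nu> in sequentially. \<exists>y\<in>C \<nu>. dist y z < e"
      by eventually_elim auto
  qed
next
  assume *: "\<forall>e>0. \<forall>\<^sub>F \<nu> in sequentially. \<exists>y\<in>C \<nu>. dist y z < e"
  \<comment> \<open>The infimal distance may not be attained, hence the vanishing slack
    \<open>1 / Suc \<nu>\<close>.\<close>
  have "\<exists>y. C \<nu> \<noteq> {} \<longrightarrow> y \<in> C \<nu> \<and> dist z y < infdist z (C \<nu>) + 1 / Suc \<nu>" for \<nu>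
  proof (cases "C \<nu> = {}")
    case False
    then have "(INF y\<in>C \<nu>. dist z y) < infdist z (C \<nu>) + 1 / Suc \<nu>"
      by (simp add: infdist_notempty)
    then show ?thesis
      using False by (subst (asm) cINF_less_iff) auto
  qed simp
  then obtain y where y: "\<And>\<nu>. C \<nu> \<noteq> {} \<Longrightarrow> y \<nu> \<in> C \<nu> \<and> dist z (y \<nu>) < infdist z (C \<nu>) + 1 / Suc \<nu>"
    by metis
  have "y \<longlonglongrightarrow> z"
  proof (rule tendstoI)
    fix e :: real assume e: "e > 0"
    then have "\<forall>\<^sub>F \<nu> in sequentially. \<exists>y\<in>C \<nu>. dist y z < e / 2"
      using * half_gt_zero by blast
    moreover have "\<forall>\<^sub>F \<nu> in sequentially. 1 / Suc \<nu> < e / 2"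
      by (rule order_tendstoD(2)[OF LIMSEQ_Suc[OF lim_1_over_n]]) (use e in simp)
    ultimately show "\<forall>\<^sub>F \<nu> in sequentially. dist (y \<nu>) z < e"
    proof eventually_elim
      case (elim \<nu>)
      then obtain w where "w \<in> C \<nu>" "dist w z < e / 2" by blast
      then show ?case
        using y[of \<nu>] infdist_le[of w "C \<nu>" z] elim(2) by (fastforce simp: dist_commute)
    qed
  qed
  moreover have "\<forall>\<^sub>F \<nu> in sequentially. \<exists>y\<in>C \<nu>. dist y z < 1"
    using * by simp
  then have "\<forall>\<^sub>F \<nu> in sequentially. y \<nu> \<in> C \<nu>"
    by eventually_elim (use y in auto)
  ultimately show "z \<in> LimInn C"
    unfolding LimInn_def by blast
qed

text \<open>This carries membership in the inner limit from a dense set of minimizers to all of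
  them.\<close>

lemma closed_LimInn:
  fixes C :: "nat \<Rightarrow> 'a::metric_space set"
  shows "closed (LimInn C)"
  unfolding closed_sequential_limits
proof (intro allI impI, elim conjE)
  fix x and l :: 'a assume x: "\<forall>n. x n \<in> LimInn C" "x \<longlonglongrightarrow> l"
  show "l \<in> LimInn C"
    unfolding LimInn_iff
  proof (intro allI impI)
    fix e :: real assume e: "0 < e"
    then obtain n where n: "dist (x n) l < e / 2"
      using x(2) unfolding lim_sequentially by (meson half_gt_zero order_refl)
    have "\<forall>\<^sub>F \<nu> in sequentially. \<exists>y\<in>C \<nu>. dist y (x n) < e / 2"
      using x(1) e half_gt_zero unfolding LimInn_iff by blast
    then show "\<forall>\<^sub>F \<nu> in sequentially. \<exists>y\<in>C \<nu>. dist y l < e"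
      by eventually_elim (use n in \<open>metis dist_triangle_half_l dist_commute\<close>)
  qed
qed

text \<open>Membership holds from some index on, so a tail of the naturals serves as the infinite
  index set.\<close>

lemma LimInn_subset_LimOut: "LimInn C \<subseteq> LimOut C"
proof
  fix z assume "z \<in> LimInn C"
  then obtain y where y: "\<forall>\<^sub>F \<nu> in sequentially. y \<nu> \<in> C \<nu>" "y \<longlonglongrightarrow> z"
    unfolding LimInn_def by blast
  then obtain \<nu>0 where "\<And>\<nu>. \<nu> \<ge> \<nu>0 \<Longrightarrow> y \<nu> \<in> C \<nu>"
    unfolding eventually_sequentially by blast
  moreover have "(y \<longlongrightarrow> z) (along {\<nu>0..})"
    using y(2) by (rule tendsto_mono[rotated]) simp
  ultimately show "z \<in> LimOut C"
    unfolding LimOut_def by (auto intro!: exI[of _ "{\<nu>0..}"] exI[of _ y] infinite_Ici)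
qed

lemma LimInn_mono_eventually:
  assumes "\<forall>\<^sub>F \<nu> in sequentially. C \<nu> \<subseteq> D \<nu>"
  shows "LimInn C \<subseteq> LimInn D"
proof
  fix z assume "z \<in> LimInn C"
  then obtain y where y: "\<forall>\<^sub>F \<nu> in sequentially. y \<nu> \<in> C \<nu>" "y \<longlonglongrightarrow> z"
    unfolding LimInn_def by blast
  from y(1) assms have "\<forall>\<^sub>F \<nu> in sequentially. y \<nu> \<in> D \<nu>"
    by eventually_elim auto
  then show "z \<in> LimInn D"
    unfolding LimInn_def using y(2) by blast
qed

lemma eps_argmin_mono: "\<epsilon> \<le> \<epsilon>' \<Longrightarrow> eps_argmin \<epsilon> \<psi> \<subseteq> eps_argmin \<epsilon>' \<psi>"
  unfolding eps_argmin_def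
  by (auto elim!: order_trans intro!: add_left_mono)

lemma eps_argmin_0: "eps_argmin 0 \<psi> = argmin_set \<psi>"
  unfolding eps_argmin_def argmin_set_def
  by (auto intro: antisym INF_lower)

lemma null_sequence_dominating:
  fixes a :: "nat \<Rightarrow> nat \<Rightarrow> real"
  assumes nonneg: "\<And>j \<nu>. 0 \<le> a j \<nu>" and null: "\<And>j. a j \<longlonglongrightarrow> 0"
  obtains b where "\<And>\<nu>. 0 \<le> b \<nu>" "b \<longlonglongrightarrow> 0" "\<And>j. \<forall>\<^sub>F \<nu> in sequentially. a j \<nu> \<le> b \<nu>"
proof
  \<comment> \<open>The cap \<open>1 / Suc j\<close> leaves only finitely many \<open>j\<close> to control, and is eventually inactive for each \<open>j\<close>.\<close>
  define b where "b \<nu> = (SUP j. min (a j \<nu>) (1 / Suc j))" for \<nu>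
  have bdd: "bdd_above (range (\<lambda>j. min (a j \<nu>) (1 / Suc j)))" for \<nu>
    by (rule bdd_aboveI[of _ 1]) (auto simp: min_le_iff_disj)
  have lower: "min (a j \<nu>) (1 / Suc j) \<le> b \<nu>" for j \<nu>
    unfolding b_def by (rule cSUP_upper[OF _ bdd]) simp
  show nonneg_b: "0 \<le> b \<nu>" for \<nu>
    using lower[of 0 \<nu>] nonneg[of 0 \<nu>] by (simp add: min_def split: if_splits)
  show "\<forall>\<^sub>F \<nu> in sequentially. a j \<nu> \<le> b \<nu>" for j
  proof -
    have "\<forall>\<^sub>F \<nu> in sequentially. a j \<nu> < 1 / Suc j"
      by (rule order_tendstoD(2)[OF null]) simp
    then show ?thesis
      by eventually_elim (use lower in \<open>metis less_eq_real_def min.absorb1\<close>)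
  qed
  show "b \<longlonglongrightarrow> 0"
  proof (rule order_tendstoI)
    show "\<forall>\<^sub>F \<nu> in sequentially. e < b \<nu>" if "e < 0" for e
      using that nonneg_b by (auto intro: always_eventually less_le_trans)
    fix e :: real assume e: "0 < e"
    \<comment> \<open>A supremum of terms below \<open>e / 2\<close> is only known to be at most
      \<open>e / 2\<close>; halving \<open>e\<close> keeps the final bound strict.\<close>
    then obtain J :: nat where J: "1 / Suc J < e / 2"
      by (metis half_gt_zero nat_approx_posE)
    have "\<forall>\<^sub>F \<nu> in sequentially. \<forall>j\<in>{..<J}. a j \<nu> < e / 2"
      by (intro eventually_ball_finite ballI order_tendstoD(2)[OF null]) (use e in auto)
    then show "\<forall>\<^sub>F \<nu> in sequentially. b \<nu> < e"
    proof eventually_elim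
      case (elim \<nu>)
      have "b \<nu> \<le> e / 2"
        unfolding b_def
      proof (rule cSUP_least)
        fix j
        show "min (a j \<nu>) (1 / Suc j) \<le> e / 2"
        proof (cases "j < J")
          case True
          with elim have "a j \<nu> \<le> e / 2" by (auto intro: less_imp_le)
          then show ?thesis by (rule min.coboundedI1)
        next
          case False
          then have "1 / real (Suc j) \<le> 1 / Suc J"
            by (intro divide_left_mono) auto
          with J show ?thesis by simp
        qed
      qed simp
      with e show ?case by simp
    qed
  qed
qed

lemma epi_converges_set_lim_argmin:
  fixes \<psi> :: "'a::{metric_space, second_countable_topology} \<Rightarrow> ereal"
  assumes epi: "epi_converges \<psi>s \<psi>" and fin: "\<bar>INF z. \<psi> z\<bar> \<noteq> \<infinity>"
    and lim: "(\<lambda>\<nu>. INF z. \<psi>s \<nu> z) \<longlonglongrightarrow> (INF z. \<psi> z)"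
    and ne: "argmin_set \<psi> \<noteq> {}"
  shows "\<exists>\<epsilon>s. (\<forall>\<nu>. 0 \<le> \<epsilon>s \<nu>) \<and> \<epsilon>s \<longlonglongrightarrow> 0 \<and>
    set_lim (\<lambda>\<nu>. eps_argmin (\<epsilon>s \<nu>) (\<psi>s \<nu>)) (argmin_set \<psi>)"
proof -
  obtain D where D: "countable D" "D \<subseteq> argmin_set \<psi>" "argmin_set \<psi> \<subseteq> closure D"
    using separable[of "argmin_set \<psi>"] by metis
  with ne have "D \<noteq> {}" by auto
  \<comment> \<open>The enumeration repeats elements when \<open>D\<close> is finite, so finite and
    infinite \<open>D\<close> need no distinction.\<close>
  with D(1) have d: "range (from_nat_into D) = D"
    by (rule range_from_nat_into[rotated])
  have "\<exists>\<epsilon>s. (\<forall>\<nu>. 0 \<le> \<epsilon>s \<nu>) \<and> \<epsilon>s \<longlonglongrightarrow> 0 \<and>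
      from_nat_into D j \<in> LimInn (\<lambda>\<nu>. eps_argmin (\<epsilon>s \<nu>) (\<psi>s \<nu>))" for j
    using d D(2) by (intro epi_converges_argmin_LimInn[OF epi fin lim]) blast
  then obtain a where a: "\<And>j \<nu>. 0 \<le> a j \<nu>" "\<And>j. a j \<longlonglongrightarrow> 0"
    "\<And>j. from_nat_into D j \<in> LimInn (\<lambda>\<nu>. eps_argmin (a j \<nu>) (\<psi>s \<nu>))"
    by metis
  obtain b where b: "\<And>\<nu>. 0 \<le> b \<nu>" "b \<longlonglongrightarrow> 0" "\<And>j. \<forall>\<^sub>F \<nu> in sequentially. a j \<nu> \<le> b \<nu>"
    by (rule null_sequence_dominating[of a, OF a(1,2)]) blast
  let ?C = "\<lambda>\<nu>. eps_argmin (b \<nu>) (\<psi>s \<nu>)"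
  have "from_nat_into D j \<in> LimInn ?C" for j
  proof -
    have "\<forall>\<^sub>F \<nu> in sequentially. eps_argmin (a j \<nu>) (\<psi>s \<nu>) \<subseteq> ?C \<nu>"
      using b(3)[of j] by eventually_elim (rule eps_argmin_mono)
    then show ?thesis
      by (rule subsetD[OF LimInn_mono_eventually a(3)])
  qed
  then have "range (from_nat_into D) \<subseteq> LimInn ?C"
    by (rule image_subsetI)
  then have "D \<subseteq> LimInn ?C"
    by (simp only: d)
  then have "argmin_set \<psi> \<subseteq> LimInn ?C"
    using D(3) closure_minimal[OF _ closed_LimInn] by blast
  \<comment> \<open>The outer inclusion holds for every null sequence of tolerances, so enlarging
    them to \<open>b\<close> does no harm here.\<close>
  moreover have "LimOut ?C \<subseteq> argmin_set \<psi>"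
    using epi_converges_LimOut_eps_argmin[OF epi _ b(2)] fin
    by (auto simp: eps_argmin_0 less_top)
  ultimately have "set_lim ?C (argmin_set \<psi>)"
    using LimInn_subset_LimOut[of ?C] unfolding set_lim_def by blast
  with b(1,2) show ?thesis by blast
qed

subsection \<open>Epi-convergence of penalized functions\<close>

text \<open>\<open>lsc_fun\<close> concerns punctured neighbourhoods; the centre is added through
  \<open>c < \<psi> z\<close>.\<close>

lemma lsc_fun_eventually_less:
  fixes \<psi> :: "'a::topological_space \<Rightarrow> ereal"
  assumes "lsc_fun \<psi>" "c < \<psi> z"
  shows "\<forall>\<^sub>F w in nhds z. c < \<psi> w"
proof -
  have "\<psi> z \<le> Liminf (at z) \<psi>"
    using assms(1) by (simp add: lsc_fun_def)
  with assms(2) have "\<forall>\<^sub>F w in at z. c < \<psi> w"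
    unfolding le_Liminf_iff by blast
  then show ?thesis
    unfolding eventually_at_filter by eventually_elim (use assms(2) in auto)
qed

lemma lsc_fun_le_liminf:
  fixes \<psi> :: "'a::topological_space \<Rightarrow> ereal"
  assumes "lsc_fun \<psi>" "y \<longlonglongrightarrow> z"
  shows "\<psi> z \<le> liminf (\<lambda>\<nu>. \<psi> (y \<nu>))"
  unfolding le_Liminf_iff
  using eventually_compose_filterlim[OF lsc_fun_eventually_less[OF assms(1)] assms(2)] by blast

text \<open>Monotonicity lets one-sided componentwise control of the arguments replace convergence.\<close>

lemma mono_lsc_fun_le_liminf:
  fixes h :: "real ^ 'm \<Rightarrow> ereal"
  assumes h: "mono h" "lsc_fun h"
    and Y: "\<And>i c. c < y $ i \<Longrightarrow> \<forall>\<^sub>F \<nu> in sequentially. c < Y \<nu> $ i"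
  shows "h y \<le> liminf (\<lambda>\<nu>. h (Y \<nu>))"
  unfolding le_Liminf_iff
proof (intro allI impI)
  fix c assume "c < h y"
  \<comment> \<open>Here \<open>1\<close> is the all-ones vector. Lowering every component of
    \<open>y\<close> slightly keeps \<open>h\<close> above \<open>c\<close> by lower semicontinuity,
    and the lowered point is eventually dominated by \<open>Y \<nu>\<close>, as there are finitely
    many components.\<close>
  have "(\<lambda>k. y - (1 / Suc k) *\<^sub>R 1) \<longlonglongrightarrow> y - 0 *\<^sub>R (1 :: real ^ 'm)"
    by (intro tendsto_intros LIMSEQ_Suc lim_1_over_n)
  then have "\<forall>\<^sub>F k in sequentially. c < h (y - (1 / Suc k) *\<^sub>R 1)"
    using eventually_compose_filterlim[OF lsc_fun_eventually_less[OF h(2) \<open>c < h y\<close>]] by simp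
  then obtain k where k: "c < h (y - (1 / Suc k) *\<^sub>R 1)"
    unfolding eventually_sequentially by blast
  have "\<forall>\<^sub>F \<nu> in sequentially. \<forall>i. y $ i - 1 / Suc k < Y \<nu> $ i"
    by (intro eventually_all_finite Y) simp
  then show "\<forall>\<^sub>F \<nu> in sequentially. c < h (Y \<nu>)"
  proof eventually_elim
    case (elim \<nu>)
    then have "y - (1 / Suc k) *\<^sub>R 1 \<le> Y \<nu>"
      by (simp add: less_eq_vec_def less_imp_le)
    from k monoD[OF h(1) this] show ?case
      by (rule less_le_trans)
  qed
qed

text \<open>Excluding \<open>-\<infinity>\<close> for \<open>a\<close> and \<open>b\<close> excludes
  it for both lower limits, so their sum is never of opposite infinities.\<close>

lemma le_liminf_add:
  fixes a b :: ereal
  assumes "a \<le> liminf A" "b \<le> liminf B" "a \<noteq> -\<infinity>" "b \<noteq> -\<infinity>"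
  shows "a + b \<le> liminf (\<lambda>\<nu>. A \<nu> + B \<nu>)"
proof -
  have "a + b \<le> liminf A + liminf B"
    by (rule add_mono) fact+
  also have "\<dots> \<le> liminf (\<lambda>\<nu>. A \<nu> + B \<nu>)"
    by (rule ereal_liminf_add_mono) (use assms in auto)
  finally show ?thesis .
qed

text \<open>The expectations enter only through a joint one-sided limit, a pointwise limit and a
  rate. This separates the penalty argument from measure theory.\<close>

lemma epi_converges_penalty:
  fixes g0 :: "'x::topological_space \<Rightarrow> ereal" and h :: "real ^ 'm \<Rightarrow> ereal"
    and E :: "'x \<Rightarrow> real ^ 'm" and Es :: "nat \<Rightarrow> 'x \<Rightarrow> real ^ 'm"
  assumes g0: "proper_fun g0" "lsc_fun g0"
    and h: "proper_fun h" "lsc_fun h" "mono h"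
    and \<alpha>: "1 \<le> \<alpha>" and lam: "\<And>\<nu>. 0 < lam \<nu>" "lam \<longlonglongrightarrow> 0"
    and Es_lsc: "\<And>x xs i c. xs \<longlonglongrightarrow> x \<Longrightarrow> c < E x $ i \<Longrightarrow> \<forall>\<^sub>F \<nu> in sequentially. c < Es \<nu> (xs \<nu>) $ i"
    and Es_lim: "\<And>x. (\<lambda>\<nu>. Es \<nu> x) \<longlonglongrightarrow> E x"
    and Es_rate: "\<And>x. (\<lambda>\<nu>. 1 / lam \<nu> * norm (E x - Es \<nu> x) powr \<alpha>) \<longlonglongrightarrow> 0"
    and f: "\<And>u x. f (u, x) = g0 x + h (u + E x) + iota {0} u"
    and fs: "\<And>\<nu> u x. fs \<nu> (u, x) =
      g0 x + h (u + Es \<nu> x) + ereal (1 / (\<alpha> * lam \<nu>) * norm u powr \<alpha>)"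
  shows "epi_converges fs f"
  unfolding epi_converges_def
proof (intro allI conjI impI)
  fix z :: "(real ^ 'm) \<times> 'x" and y assume y: "y \<longlonglongrightarrow> z"
  define u x where "u = fst z" and "x = snd z"
  define us xs where "us = (\<lambda>\<nu>. fst (y \<nu>))" and "xs = (\<lambda>\<nu>. snd (y \<nu>))"
  have us: "us \<longlonglongrightarrow> u" and xs: "xs \<longlonglongrightarrow> x"
    unfolding us_def xs_def u_def x_def using y by (intro tendsto_intros; simp)+
  let ?p = "\<lambda>\<nu>. 1 / (\<alpha> * lam \<nu>) * norm (us \<nu>) powr \<alpha>"
  have ne: "g0 x \<noteq> -\<infinity>" "h (u + E x) \<noteq> -\<infinity>"
    using g0 h by (auto simp: proper_fun_def)
  have "g0 x \<le> liminf (\<lambda>\<nu>. g0 (xs \<nu>))"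
    using g0(2) xs by (rule lsc_fun_le_liminf)
  moreover have "h (u + E x) \<le> liminf (\<lambda>\<nu>. h (us \<nu> + Es \<nu> (xs \<nu>)))"
  proof (rule mono_lsc_fun_le_liminf[OF h(3,2)])
    fix i c assume c: "c < (u + E x) $ i"
    \<comment> \<open>Half of the gap is granted to \<open>us\<close>, half to
      \<open>Es\<close>.\<close>
    define d where "d = ((u + E x) $ i - c) / 2"
    have d: "d > 0" using c by (simp add: d_def)
    have "(\<lambda>\<nu>. us \<nu> $ i) \<longlonglongrightarrow> u $ i"
      using us by (rule tendsto_vec_nth)
    then have "\<forall>\<^sub>F \<nu> in sequentially. u $ i - d < us \<nu> $ i"
      by (rule order_tendstoD(1)) (use d in simp)
    moreover have "\<forall>\<^sub>F \<nu> in sequentially. E x $ i - d < Es \<nu> (xs \<nu>) $ i"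
      by (rule Es_lsc[OF xs]) (use d in simp)
    ultimately show "\<forall>\<^sub>F \<nu> in sequentially. c < (us \<nu> + Es \<nu> (xs \<nu>)) $ i"
    proof eventually_elim
      case (elim \<nu>)
      then show ?case by (simp add: d_def field_simps)
    qed
  qed
  moreover have "iota {0} u \<le> liminf (\<lambda>\<nu>. ereal (?p \<nu>))"
  proof (cases "u = 0")
    case True
    have "0 \<le> ?p \<nu>" for \<nu>
      using \<alpha> lam(1)[of \<nu>] by simp
    then have "0 \<le> liminf (\<lambda>\<nu>. ereal (?p \<nu>))"
      by (intro Liminf_bounded always_eventually allI) (simp only: ereal_less_eq zero_ereal_def)
    then show ?thesis
      using True by (simp add: iota_def)
  next
    case False
    \<comment> \<open>The penalty coefficient tends to infinity, while
      \<open>norm (us \<nu>) powr \<alpha>\<close> has a positive limit for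
      \<open>u \<noteq> 0\<close>.\<close>
    have "filterlim (\<lambda>\<nu>. \<alpha> * lam \<nu>) (at_right 0) sequentially"
      unfolding filterlim_at
    proof
      show "(\<lambda>\<nu>. \<alpha> * lam \<nu>) \<longlonglongrightarrow> 0"
        using tendsto_mult[OF tendsto_const lam(2), of \<alpha>] by simp
      show "\<forall>\<^sub>F \<nu> in sequentially. \<alpha> * lam \<nu> \<in> {0<..} \<and> \<alpha> * lam \<nu> \<noteq> 0"
      proof (intro always_eventually allI)
        fix \<nu>
        have "0 < \<alpha> * lam \<nu>" using \<alpha> lam(1)[of \<nu>] by simp
        then show "\<alpha> * lam \<nu> \<in> {0<..} \<and> \<alpha> * lam \<nu> \<noteq> 0" by auto
      qed
    qed
    from filterlim_compose[OF filterlim_inverse_at_top_right this]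
    have coeff: "filterlim (\<lambda>\<nu>. 1 / (\<alpha> * lam \<nu>)) at_top sequentially"
      by (simp only: inverse_eq_divide)
    have "(\<lambda>\<nu>. norm (us \<nu>) powr \<alpha>) \<longlonglongrightarrow> norm u powr \<alpha>"
      by (intro tendsto_intros us) (use False in simp)
    then have "filterlim ?p at_top sequentially"
      by (rule filterlim_at_top_mult_tendsto_pos[OF _ _ coeff]) (use False in simp)
    then have "(\<lambda>\<nu>. ereal (?p \<nu>)) \<longlonglongrightarrow> \<infinity>"
      by (simp only: tendsto_PInfty_eq_at_top)
    then have "liminf (\<lambda>\<nu>. ereal (?p \<nu>)) = \<infinity>"
      by (intro lim_imp_Liminf) simp
    then show ?thesis
      by (simp only: ereal_less_eq)
  qed
  ultimately have "g0 x + h (u + E x) + iota {0} u \<le>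
      liminf (\<lambda>\<nu>. g0 (xs \<nu>) + h (us \<nu> + Es \<nu> (xs \<nu>)) + ereal (?p \<nu>))"
    using ne by (intro le_liminf_add) (auto simp: iota_def)
  moreover have "fs \<nu> (y \<nu>) = g0 (xs \<nu>) + h (us \<nu> + Es \<nu> (xs \<nu>)) + ereal (?p \<nu>)" for \<nu>
    using fs[of \<nu> "us \<nu>" "xs \<nu>"] by (simp add: us_def xs_def)
  moreover have "f z = g0 x + h (u + E x) + iota {0} u"
    using f[of u x] by (simp add: u_def x_def)
  ultimately show "f z \<le> liminf (\<lambda>\<nu>. fs \<nu> (y \<nu>))"
    by simp
next
  fix z :: "(real ^ 'm) \<times> 'x"
  obtain u x where z: "z = (u, x)" by (cases z)
  show "\<exists>y. y \<longlonglongrightarrow> z \<and> limsup (\<lambda>\<nu>. fs \<nu> (y \<nu>)) \<le> f z"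
  proof (cases "u = 0")
    case False
    then have "f z = \<infinity>"
      using g0 h by (auto simp: z f iota_def proper_fun_def)
    then show ?thesis by (intro exI[of _ "\<lambda>_. z"]) simp
  next
    case True
    \<comment> \<open>The argument of \<open>h\<close> is then exactly \<open>E x\<close> for every
      \<open>\<nu>\<close>, so no continuity of \<open>h\<close> is called for and only the penalty
      varies.\<close>
    let ?y = "\<lambda>\<nu>. (E x - Es \<nu> x, x)"
    have "?y \<longlonglongrightarrow> (E x - E x, x)"
      by (intro tendsto_intros Es_lim)
    moreover have "(\<lambda>\<nu>. 1 / \<alpha> * (1 / lam \<nu> * norm (E x - Es \<nu> x) powr \<alpha>)) \<longlonglongrightarrow> 1 / \<alpha> * 0"
      by (intro tendsto_intros Es_rate)
    then have "(\<lambda>\<nu>. ereal (1 / (\<alpha> * lam \<nu>) * norm (E x - Es \<nu> x) powr \<alpha>)) \<longlonglongrightarrow> ereal 0"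
      by (intro tendsto_ereal) (simp add: mult.assoc)
    then have "(\<lambda>\<nu>. g0 x + h (E x) + ereal (1 / (\<alpha> * lam \<nu>) * norm (E x - Es \<nu> x) powr \<alpha>))
        \<longlonglongrightarrow> g0 x + h (E x) + ereal 0"
      by (intro tendsto_add_ereal_general tendsto_const) auto
    then have "limsup (\<lambda>\<nu>. fs \<nu> (?y \<nu>)) = f z"
      by (intro lim_imp_Limsup) (simp_all add: fs f z True iota_def)
    ultimately show ?thesis
      by (intro exI[of _ ?y]) (simp add: z True)
  qed
qed

subsection \<open>Expectations under total variation convergence\<close>

text \<open>The point \<open>(x, c)\<close> lies outside the closed epigraph, and so does a product
  neighbourhood of it.\<close>

lemma random_lsc_eventually_less:
  fixes g :: "'d::topological_space \<Rightarrow> 'a::topological_space \<Rightarrow> real"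
  assumes "random_lsc \<Xi> (\<lambda>\<xi> x. ereal (g \<xi> x))" "\<xi> \<in> \<Xi>" "c < g \<xi> x"
  shows "\<forall>\<^sub>F y in nhds x. c < g \<xi> y"
proof -
  let ?E = "epi (\<lambda>y. ereal (g \<xi> y))"
  have "open (- ?E)" "(x, c) \<in> - ?E"
    using assms by (auto simp: random_lsc_def epi_def)
  then obtain A B where AB: "open A" "open B" "x \<in> A" "c \<in> B" "A \<times> B \<subseteq> - ?E"
    by (metis open_prod_elim mem_Times_iff fst_conv snd_conv)
  have "c < g \<xi> y" if "y \<in> A" for y
  proof -
    have "(y, c) \<in> - ?E" using that AB by blast
    then show ?thesis by (simp add: epi_def)
  qed
  with AB(1,3) show ?thesis
    unfolding eventually_nhds by blast
qed

text \<open>By closedness, \<open>(x, a)\<close> belongs to the epigraph iff each of countably many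
  shrinking balls around it meets the epigraph, and each of these events is measurable.\<close>

lemma random_lsc_measurable:
  fixes g :: "'d::topological_space \<Rightarrow> 'a::metric_space \<Rightarrow> real"
  assumes g: "random_lsc \<Xi> (\<lambda>\<xi> x. ereal (g \<xi> x))"
  shows "(\<lambda>\<xi>. g \<xi> x) \<in> borel_measurable (restrict_space borel \<Xi>)"
  unfolding borel_measurable_iff_le
proof
  fix a
  let ?E = "\<lambda>\<xi>. epi (\<lambda>y. ereal (g \<xi> y))"
  have eq: "{\<xi> \<in> \<Xi>. g \<xi> x \<le> a} = (\<Inter>n. {\<xi> \<in> \<Xi>. ?E \<xi> \<inter> ball (x, a) (1 / Suc n) \<noteq> {}})"
  proof (intro set_eqI iffI)
    fix \<xi> assume "\<xi> \<in> {\<xi> \<in> \<Xi>. g \<xi> x \<le> a}"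
    then have "\<xi> \<in> \<Xi>" "(x, a) \<in> ?E \<xi> \<inter> ball (x, a) (1 / Suc n)" for n
      by (auto simp: epi_def)
    then show "\<xi> \<in> (\<Inter>n. {\<xi> \<in> \<Xi>. ?E \<xi> \<inter> ball (x, a) (1 / Suc n) \<noteq> {}})" by blast
  next
    fix \<xi> assume \<xi>: "\<xi> \<in> (\<Inter>n. {\<xi> \<in> \<Xi>. ?E \<xi> \<inter> ball (x, a) (1 / Suc n) \<noteq> {}})"
    then have "\<xi> \<in> \<Xi>" by blast
    with g have "closed (?E \<xi>)" by (simp add: random_lsc_def)
    moreover have "(x, a) \<in> closure (?E \<xi>)"
      unfolding closure_approachable
    proof (intro allI impI)
      fix e :: real assume "0 < e"
      then obtain n where n: "1 / Suc n < e" by (metis nat_approx_posE)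
      from \<xi> obtain w where "w \<in> ?E \<xi>" "w \<in> ball (x, a) (1 / Suc n)" by blast
      with n show "\<exists>w\<in>?E \<xi>. dist w (x, a) < e"
        by (intro bexI[of _ w]) (auto simp: dist_commute)
    qed
    ultimately show "\<xi> \<in> {\<xi> \<in> \<Xi>. g \<xi> x \<le> a}"
      using \<open>\<xi> \<in> \<Xi>\<close> by (simp add: epi_def)
  qed
  have "{\<xi> \<in> \<Xi>. ?E \<xi> \<inter> ball (x, a) (1 / Suc n) \<noteq> {}} \<in> sets (restrict_space borel \<Xi>)" for n
    using g unfolding random_lsc_def by blast
  then show "{\<xi> \<in> space (restrict_space borel \<Xi>). g \<xi> x \<le> a} \<in> sets (restrict_space borel \<Xi>)"
    by (simp add: space_restrict_space eq sets.countable_INT)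
qed

section \<open>Bounded integrands and total variation\<close>

context
  fixes \<Xi> :: "'d::topological_space set" and \<mu> :: "'d measure"
  assumes \<mu>: "\<mu> \<in> prob_measures_on \<Xi>"
begin

lemma prob_measures_on_space: "space \<mu> = \<Xi>"
  using \<mu> sets_eq_imp_space_eq[of \<mu> "restrict_space borel \<Xi>"]
  by (simp add: prob_measures_on_def space_restrict_space)

lemma prob_measures_on_measurable:
  "g \<in> borel_measurable (restrict_space borel \<Xi>) \<Longrightarrow> g \<in> borel_measurable \<mu>"
  using \<mu> by (simp add: prob_measures_on_def cong: measurable_cong_sets)

lemma prob_measures_on_integrable:
  fixes g :: "'d \<Rightarrow> real"
  assumes "g \<in> borel_measurable (restrict_space borel \<Xi>)" "\<And>\<xi>. \<xi> \<in> \<Xi> \<Longrightarrow> \<bar>g \<xi>\<bar> \<le> M"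
  shows "integrable \<mu> g"
proof -
  interpret prob_space \<mu> using \<mu> by (simp add: prob_measures_on_def)
  show ?thesis
    by (rule integrable_const_bound[of _ M])
      (use assms prob_measures_on_measurable in \<open>auto simp: prob_measures_on_space\<close>)
qed

lemma prob_measures_on_abs_integral_le:
  fixes g :: "'d \<Rightarrow> real"
  assumes "g \<in> borel_measurable (restrict_space borel \<Xi>)" "\<And>\<xi>. \<xi> \<in> \<Xi> \<Longrightarrow> \<bar>g \<xi>\<bar> \<le> M"
  shows "\<bar>LINT \<xi>|\<mu>. g \<xi>\<bar> \<le> M"
proof -
  interpret prob_space \<mu> using \<mu> by (simp add: prob_measures_on_def)
  have "\<bar>LINT \<xi>|\<mu>. g \<xi>\<bar> \<le> (LINT \<xi>|\<mu>. \<bar>g \<xi>\<bar>)"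
    using integral_norm_bound[of \<mu> g] by simp
  also have "\<dots> \<le> (LINT \<xi>|\<mu>. M)"
    by (intro integral_mono integrable_abs prob_measures_on_integrable[OF assms])
      (use assms(2) in \<open>auto simp: prob_measures_on_space\<close>)
  finally show ?thesis by (simp add: prob_space)
qed

end

text \<open>Both \<open>g / M\<close> and \<open>- g / M\<close> are admissible test functions in
  the supremum.\<close>

lemma abs_integral_diff_le_tv_dist:
  fixes g :: "'d::topological_space \<Rightarrow> real"
  assumes \<mu>: "\<mu>1 \<in> prob_measures_on \<Xi>" "\<mu>2 \<in> prob_measures_on \<Xi>"
    and g: "g \<in> borel_measurable (restrict_space borel \<Xi>)" "\<And>\<xi>. \<xi> \<in> \<Xi> \<Longrightarrow> \<bar>g \<xi>\<bar> \<le> M"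
    and M: "0 < M"
  shows "\<bar>(LINT \<xi>|\<mu>1. g \<xi>) - (LINT \<xi>|\<mu>2. g \<xi>)\<bar> \<le> M * tv_dist \<Xi> \<mu>1 \<mu>2"
proof -
  let ?L = "{l \<in> borel_measurable (restrict_space borel \<Xi>). \<forall>\<xi>\<in>\<Xi>. l \<xi> \<in> {-1..1::real}}"
  let ?D = "\<lambda>l. (LINT \<xi>|\<mu>1. l \<xi>) - (LINT \<xi>|\<mu>2. l \<xi>)"
  \<comment> \<open>A real supremum bounds its members only once the set is known to be bounded
    above.\<close>
  have "?D l \<le> 2" if "l \<in> ?L" for l
  proof -
    have "\<bar>LINT \<xi>|\<mu>1. l \<xi>\<bar> \<le> 1" "\<bar>LINT \<xi>|\<mu>2. l \<xi>\<bar> \<le> 1"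
      using that by (intro prob_measures_on_abs_integral_le[OF \<mu>(1)]
          prob_measures_on_abs_integral_le[OF \<mu>(2)]; force simp: abs_le_iff)+
    then show ?thesis by linarith
  qed
  then have bdd: "bdd_above (?D ` ?L)" by (intro bdd_aboveI2)
  have le: "?D l \<le> tv_dist \<Xi> \<mu>1 \<mu>2" if "l \<in> ?L" for l
    unfolding tv_dist_def using that bdd by (rule cSUP_upper)
  have "(\<lambda>\<xi>. s * g \<xi> / M) \<in> ?L" if "\<bar>s\<bar> = 1" for s
  proof -
    have "s * g \<xi> / M \<in> {-1..1}" if "\<xi> \<in> \<Xi>" for \<xi>
    proof -
      have "\<bar>s * g \<xi> / M\<bar> \<le> 1"
        using g(2)[OF that] M \<open>\<bar>s\<bar> = 1\<close> by (simp add: abs_mult)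
      then show ?thesis
        unfolding atLeastAtMost_iff by (intro conjI; linarith)
    qed
    with g(1) show ?thesis by simp
  qed
  from le[OF this[of 1]] le[OF this[of "-1"]]
  have "?D g / M \<le> tv_dist \<Xi> \<mu>1 \<mu>2" "- (?D g) / M \<le> tv_dist \<Xi> \<mu>1 \<mu>2"
    by (simp_all add: diff_divide_distrib)
  then show ?thesis
    using M by (simp add: field_simps abs_le_iff)
qed

lemma tv_dist_nonneg:
  assumes "\<mu>1 \<in> prob_measures_on \<Xi>" "\<mu>2 \<in> prob_measures_on \<Xi>"
  shows "0 \<le> tv_dist \<Xi> \<mu>1 \<mu>2"
  using abs_integral_diff_le_tv_dist[OF assms, of "\<lambda>_. 0" 1] by simp

text \<open>Dominated convergence is applied to the minimum of the integrands at the moving point and at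
  the limit, which converges pointwise by lower semicontinuity.\<close>

lemma integral_random_lsc_eventually_less:
  fixes g :: "'d::topological_space \<Rightarrow> 'a::real_normed_vector \<Rightarrow> real"
  assumes \<mu>: "\<mu> \<in> prob_measures_on \<Xi>"
    and lsc: "random_lsc \<Xi> (\<lambda>\<xi> x. ereal (g \<xi> x))" and bdd: "unif_bounded_locally \<Xi> g"
    and c: "c < (LINT \<xi>|\<mu>. g \<xi> x)"
  shows "\<forall>\<^sub>F y in nhds x. c < (LINT \<xi>|\<mu>. g \<xi> y)"
proof -
  interpret prob_space \<mu> using \<mu> by (simp add: prob_measures_on_def)
  note meas = prob_measures_on_measurable[OF \<mu> random_lsc_measurable[OF lsc]]
  note space = prob_measures_on_space[OF \<mu>]
  obtain \<epsilon> M where \<epsilon>: "\<epsilon> > 0" and M: "\<And>\<xi> y. \<xi> \<in> \<Xi> \<Longrightarrow> norm (y - x) \<le> \<epsilon> \<Longrightarrow> \<bar>g \<xi> y\<bar> \<le> M"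
    using bdd unfolding unif_bounded_locally_def by metis
  \<comment> \<open>Dominated convergence is sequential, so the neighbourhood is tested by
    sequences; inside the ball the constant \<open>M\<close> dominates every term.\<close>
  have "\<forall>\<^sub>F y in inf (nhds x) (principal (cball x \<epsilon>)). c < (LINT \<xi>|\<mu>. g \<xi> y)"
  proof (rule sequentially_imp_eventually_nhds_within, intro allI impI, elim conjE)
    fix y assume in_ball: "\<forall>n. y n \<in> cball x \<epsilon>" and y: "y \<longlonglongrightarrow> x"
    have M': "\<bar>g \<xi> (y n)\<bar> \<le> M" "\<bar>g \<xi> x\<bar> \<le> M" if "\<xi> \<in> \<Xi>" for \<xi> n
      using that M[of \<xi>] in_ball \<epsilon> by (auto simp: dist_norm norm_minus_commute)
    have ptw: "(\<lambda>n. min (g \<xi> (y n)) (g \<xi> x)) \<longlonglongrightarrow> g \<xi> x" if "\<xi> \<in> \<Xi>" for \<xi>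
    proof (rule order_tendstoI)
      fix a assume a: "a < g \<xi> x"
      then have "\<forall>\<^sub>F n in sequentially. a < g \<xi> (y n)"
        using eventually_compose_filterlim[OF random_lsc_eventually_less[OF lsc that] y] by blast
      then show "\<forall>\<^sub>F n in sequentially. a < min (g \<xi> (y n)) (g \<xi> x)"
        by eventually_elim (use a in simp)
    next
      fix a assume "g \<xi> x < a"
      then show "\<forall>\<^sub>F n in sequentially. min (g \<xi> (y n)) (g \<xi> x) < a"
        by (simp add: min_less_iff_disj)
    qed
    have "(\<lambda>n. LINT \<xi>|\<mu>. min (g \<xi> (y n)) (g \<xi> x)) \<longlonglongrightarrow> (LINT \<xi>|\<mu>. g \<xi> x)"
    proof (rule integral_dominated_convergence[where w = "\<lambda>_. M"])
      show "AE \<xi> in \<mu>. norm (min (g \<xi> (y n)) (g \<xi> x)) \<le> M" for n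
        using M' by (intro AE_I2) (simp add: space abs_le_iff min_def)
      show "AE \<xi> in \<mu>. (\<lambda>n. min (g \<xi> (y n)) (g \<xi> x)) \<longlonglongrightarrow> g \<xi> x"
        using ptw by (intro AE_I2) (simp add: space)
    qed (use meas in auto)
    then have "\<forall>\<^sub>F n in sequentially. c < (LINT \<xi>|\<mu>. min (g \<xi> (y n)) (g \<xi> x))"
      using c by (rule order_tendstoD(1))
    then show "\<forall>\<^sub>F n in sequentially. c < (LINT \<xi>|\<mu>. g \<xi> (y n))"
    proof eventually_elim
      case (elim n)
      have int: "integrable \<mu> (\<lambda>\<xi>. g \<xi> (y n))" "integrable \<mu> (\<lambda>\<xi>. g \<xi> x)"
        using M' by (auto intro!: integrable_const_bound[of _ M] AE_I2 meas simp: space)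
      then have "(LINT \<xi>|\<mu>. min (g \<xi> (y n)) (g \<xi> x)) \<le> (LINT \<xi>|\<mu>. g \<xi> (y n))"
        by (intro integral_mono integrable_min) auto
      with elim show ?case by simp
    qed
  qed
  moreover have "\<forall>\<^sub>F y in nhds x. y \<in> cball x \<epsilon>"
    using eventually_nhds_ball[OF \<epsilon>, of x] by eventually_elim auto
  ultimately show ?thesis
    unfolding eventually_inf_principal by eventually_elim auto
qed

lemma integral_random_lsc_eventually_less_tv:
  fixes g :: "'d::topological_space \<Rightarrow> 'a::real_normed_vector \<Rightarrow> real"
  assumes \<mu>: "\<mu> \<in> prob_measures_on \<Xi>" and \<mu>s: "\<And>\<nu>. \<mu>s \<nu> \<in> prob_measures_on \<Xi>"
    and tv: "(\<lambda>\<nu>. tv_dist \<Xi> (\<mu>s \<nu>) \<mu>) \<longlonglongrightarrow> 0"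
    and lsc: "random_lsc \<Xi> (\<lambda>\<xi> x. ereal (g \<xi> x))" and bdd: "unif_bounded_locally \<Xi> g"
    and xs: "xs \<longlonglongrightarrow> x" and c: "c < (LINT \<xi>|\<mu>. g \<xi> x)"
  shows "\<forall>\<^sub>F \<nu> in sequentially. c < (LINT \<xi>|\<mu>s \<nu>. g \<xi> (xs \<nu>))"
proof -
  obtain \<epsilon> M where \<epsilon>: "\<epsilon> > 0" and M: "\<And>\<xi> y. \<xi> \<in> \<Xi> \<Longrightarrow> norm (y - x) \<le> \<epsilon> \<Longrightarrow> \<bar>g \<xi> y\<bar> \<le> M"
    using bdd unfolding unif_bounded_locally_def by metis
  \<comment> \<open>Half of the gap pays for moving \<open>x\<close> under the fixed measure
    \<open>\<mu>\<close>, half for exchanging \<open>\<mu>\<close> at the moved point.\<close>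
  define d where "d = ((LINT \<xi>|\<mu>. g \<xi> x) - c) / 2"
  have d: "0 < d" using c by (simp add: d_def)
  have "\<forall>\<^sub>F y in nhds x. c + d < (LINT \<xi>|\<mu>. g \<xi> y)"
    by (rule integral_random_lsc_eventually_less[OF \<mu> lsc bdd]) (use c in \<open>simp add: d_def field_simps\<close>)
  then have "\<forall>\<^sub>F \<nu> in sequentially. c + d < (LINT \<xi>|\<mu>. g \<xi> (xs \<nu>))"
    using xs by (rule eventually_compose_filterlim)
  \<comment> \<open>\<open>\<bar>M\<bar> + 1\<close> is a bound that is certainly positive, as
    scaling to a test function demands.\<close>
  moreover have "(\<lambda>\<nu>. (\<bar>M\<bar> + 1) * tv_dist \<Xi> (\<mu>s \<nu>) \<mu>) \<longlonglongrightarrow> (\<bar>M\<bar> + 1) * 0"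
    by (intro tendsto_intros tv)
  then have "\<forall>\<^sub>F \<nu> in sequentially. (\<bar>M\<bar> + 1) * tv_dist \<Xi> (\<mu>s \<nu>) \<mu> < d"
    by (rule order_tendstoD(2)) (use d in simp)
  moreover have "\<forall>\<^sub>F \<nu> in sequentially. dist (xs \<nu>) x < \<epsilon>"
    using xs \<epsilon> by (rule tendstoD)
  ultimately show ?thesis
  proof eventually_elim
    case (elim \<nu>)
    have "\<bar>g \<xi> (xs \<nu>)\<bar> \<le> \<bar>M\<bar> + 1" if "\<xi> \<in> \<Xi>" for \<xi>
      using M[OF that, of "xs \<nu>"] elim(3) by (simp add: dist_norm)
    then have "\<bar>(LINT \<xi>|\<mu>s \<nu>. g \<xi> (xs \<nu>)) - (LINT \<xi>|\<mu>. g \<xi> (xs \<nu>))\<bar>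
        \<le> (\<bar>M\<bar> + 1) * tv_dist \<Xi> (\<mu>s \<nu>) \<mu>"
      by (intro abs_integral_diff_le_tv_dist[OF \<mu>s \<mu> random_lsc_measurable[OF lsc]]) auto
    with elim(1,2) show ?case by linarith
  qed
qed

text \<open>A bounded linear map commutes with the integral of an integrable function; integrability
  of \<open>F\<close> is assembled from its components by the basis expansion.\<close>

lemma integral_vec_nth_component:
  fixes F :: "'d \<Rightarrow> real ^ 'm"
  assumes "\<And>i. integrable M (\<lambda>\<xi>. F \<xi> $ i)"
  shows "(LINT \<xi>|M. F \<xi>) $ i = (LINT \<xi>|M. F \<xi> $ i)"
proof -
  have "integrable M (\<lambda>\<xi>. \<Sum>i\<in>UNIV. (F \<xi> $ i) *\<^sub>R axis i (1::real))"
    by (intro Bochner_Integration.integrable_sum integrable_scaleR_left assms)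
  moreover have "(\<lambda>\<xi>. \<Sum>i\<in>UNIV. (F \<xi> $ i) *\<^sub>R axis i (1::real)) = F"
    using basis_expansion[of "F _"] by (simp add: fun_eq_iff scalar_mult_eq_scaleR)
  ultimately have "integrable M F" by simp
  then show ?thesis
    by (rule integral_bounded_linear[OF bounded_linear_vec_nth, symmetric])
qed

theorem proposition3p11:
  fixes \<Xi> :: "(real ^ 'd) set"
    and g0 :: "real ^ 'n \<Rightarrow> ereal"
    and h :: "real ^ 'm \<Rightarrow> ereal"
    and G :: "real ^ 'd \<Rightarrow> real ^ 'n \<Rightarrow> real ^ 'm"
    and \<mu> :: "(real ^ 'd) measure"
    and \<mu>s :: "nat \<Rightarrow> (real ^ 'd) measure"
    and \<alpha> :: real
    and lam :: "nat \<Rightarrow> real"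
    and \<phi> :: "real ^ 'n \<Rightarrow> ereal"
    and f :: "(real ^ 'm) \<times> (real ^ 'n) \<Rightarrow> ereal"
    and fs :: "nat \<Rightarrow> (real ^ 'm) \<times> (real ^ 'n) \<Rightarrow> ereal"
  assumes "\<Xi> \<noteq> {}" and "closed \<Xi>"
    and "proper_fun g0" and "lsc_fun g0"
    and "proper_fun h" and "lsc_fun h" and "mono h"
    and "\<And>i. random_lsc \<Xi> (\<lambda>\<xi> x. ereal (G \<xi> x $ i))"
    and "\<And>i. unif_bounded_locally \<Xi> (\<lambda>\<xi> x. G \<xi> x $ i)"
    and "\<mu> \<in> prob_measures_on \<Xi>" and "\<And>\<nu>. \<mu>s \<nu> \<in> prob_measures_on \<Xi>"
    and "(\<lambda>\<nu>. tv_dist \<Xi> (\<mu>s \<nu>) \<mu>) \<longlonglongrightarrow> 0"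
    and "1 \<le> \<alpha>"
    and "\<And>\<nu>. 0 < lam \<nu>" and "lam \<longlonglongrightarrow> 0"
    and "(\<lambda>\<nu>. 1 / lam \<nu> * tv_dist \<Xi> (\<mu>s \<nu>) \<mu> powr \<alpha>) \<longlonglongrightarrow> 0"
    and "\<And>x. \<phi> x = g0 x + h (LINT \<xi>|\<mu>. G \<xi> x)"
    and "\<And>u x. f (u, x) = g0 x + h (u + (LINT \<xi>|\<mu>. G \<xi> x)) + iota {0} u"
    and "\<And>\<nu> u x. fs \<nu> (u, x) =
           g0 x + h (u + (LINT \<xi>|\<mu>s \<nu>. G \<xi> x)) + ereal (1 / (\<alpha> * lam \<nu>) * norm u powr \<alpha>)"
    and "argmin_set \<phi> \<noteq> {}"
  shows "epi_converges fs f
    \<and> \<comment> \<open>(a)\<close>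
      ((INF z. f z) = (INF x. \<phi> x) \<and>
       (\<forall>\<epsilon>\<ge>0. eps_argmin \<epsilon> f = {0} \<times> eps_argmin \<epsilon> \<phi>))
    \<and> \<comment> \<open>(b)\<close>
      limsup (\<lambda>\<nu>. INF z. fs \<nu> z) \<le> (INF z. f z)
    \<and> \<comment> \<open>(c)\<close>
      (\<forall>\<epsilon>s \<epsilon>. (\<forall>\<nu>. 0 \<le> \<epsilon>s \<nu>) \<and> 0 \<le> \<epsilon> \<and> \<epsilon>s \<longlonglongrightarrow> \<epsilon> \<longrightarrow>
         LimOut (\<lambda>\<nu>. eps_argmin (\<epsilon>s \<nu>) (fs \<nu>)) \<subseteq> eps_argmin \<epsilon> f)
    \<and> \<comment> \<open>(d)\<close>
      (\<forall>\<epsilon>s N us xs. (\<forall>\<nu>. 0 \<le> \<epsilon>s \<nu>) \<and> \<epsilon>s \<longlonglongrightarrow> 0 \<and> infinite N \<and>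
           (\<forall>\<nu>\<in>N. (us \<nu>, xs \<nu>) \<in> eps_argmin (\<epsilon>s \<nu>) (fs \<nu>)) \<and>
           (\<exists>z. ((\<lambda>\<nu>. (us \<nu>, xs \<nu>)) \<longlongrightarrow> z) (along N)) \<longrightarrow>
         ((\<lambda>\<nu>. INF z. fs \<nu> z) \<longlongrightarrow> (INF z. f z)) (along N))
    \<and> \<comment> \<open>(e)\<close>
      ((\<lambda>\<nu>. INF z. fs \<nu> z) \<longlonglongrightarrow> (INF z. f z) \<longleftrightarrow> tight_funs fs)
    \<and> \<comment> \<open>(f)\<close>
      ((\<lambda>\<nu>. INF z. fs \<nu> z) \<longlonglongrightarrow> (INF z. f z) \<longrightarrow>
         (\<forall>x0\<in>argmin_set \<phi>. \<exists>\<epsilon>s. (\<forall>\<nu>. 0 \<le> \<epsilon>s \<nu>) \<and> \<epsilon>s \<longlonglongrightarrow> 0 \<and>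
            (0, x0) \<in> LimInn (\<lambda>\<nu>. eps_argmin (\<epsilon>s \<nu>) (fs \<nu>))))
    \<and> \<comment> \<open>(g)\<close>
      ((\<lambda>\<nu>. INF z. fs \<nu> z) \<longlonglongrightarrow> (INF z. f z) \<longrightarrow>
         (\<exists>\<epsilon>s. (\<forall>\<nu>. 0 \<le> \<epsilon>s \<nu>) \<and> \<epsilon>s \<longlonglongrightarrow> 0 \<and>
            set_lim (\<lambda>\<nu>. eps_argmin (\<epsilon>s \<nu>) (fs \<nu>)) (argmin_set f)))"
proof -

  \<comment> \<open>Estimates for the expectations at a fixed point\<close>
  note g0 = assms(3,4) and h = assms(5,6,7) and lsc = assms(8) and bdd = assms(9)
    and \<mu> = assms(10) and \<mu>s = assms(11) and tv = assms(12) and \<alpha> = assms(13)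
    and lam = assms(14,15) and rate = assms(16) and \<phi> = assms(17) and f = assms(18)
    and fs = assms(19) and argmin_\<phi> = assms(20)
  let ?tv = "\<lambda>\<nu>. tv_dist \<Xi> (\<mu>s \<nu>) \<mu>"
  note meas = random_lsc_measurable[OF lsc]
  have tv_nonneg: "0 \<le> ?tv \<nu>" for \<nu>
    by (rule tv_dist_nonneg[OF \<mu>s \<mu>])
  have bdd_pt: "\<exists>M>0. \<forall>\<xi>\<in>\<Xi>. \<forall>i. \<bar>G \<xi> x $ i\<bar> \<le> M" for x
  proof -
    have "\<exists>M. \<forall>\<xi>\<in>\<Xi>. \<bar>G \<xi> x $ i\<bar> \<le> M" for i
      using bdd[of i] unfolding unif_bounded_locally_def
      by (metis diff_self norm_zero less_imp_le)
    then obtain M where M: "\<And>i \<xi>. \<xi> \<in> \<Xi> \<Longrightarrow> \<bar>G \<xi> x $ i\<bar> \<le> M i" by metis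
    \<comment> \<open>One bound for all components; the summand 1 makes it positive.\<close>
    have "\<bar>G \<xi> x $ i\<bar> \<le> 1 + (\<Sum>i\<in>UNIV. \<bar>M i\<bar>)" if "\<xi> \<in> \<Xi>" for \<xi> i
      using M[OF that, of i] member_le_sum[of i UNIV "\<lambda>i. \<bar>M i\<bar>"] by simp
    moreover have "0 < 1 + (\<Sum>i\<in>UNIV. \<bar>M i\<bar>)"
      by (intro add_pos_nonneg sum_nonneg) auto
    ultimately show ?thesis by blast
  qed
  have comp: "(LINT \<xi>|\<mu>'. G \<xi> x) $ i = (LINT \<xi>|\<mu>'. G \<xi> x $ i)"
    if "\<mu>' \<in> prob_measures_on \<Xi>" for \<mu>' x i
  proof (rule integral_vec_nth_component)
    obtain M where "\<forall>\<xi>\<in>\<Xi>. \<forall>i. \<bar>G \<xi> x $ i\<bar> \<le> M" using bdd_pt by blast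
    then show "integrable \<mu>' (\<lambda>\<xi>. G \<xi> x $ i)" for i
      by (intro prob_measures_on_integrable[OF that meas, where M = M]) auto
  qed
  have norm_le: "\<exists>K\<ge>0. \<forall>\<nu>. norm ((LINT \<xi>|\<mu>. G \<xi> x) - (LINT \<xi>|\<mu>s \<nu>. G \<xi> x)) \<le> K * ?tv \<nu>" for x
  proof -
    obtain M where M: "M > 0" "\<And>\<xi> i. \<xi> \<in> \<Xi> \<Longrightarrow> \<bar>G \<xi> x $ i\<bar> \<le> M" using bdd_pt by blast
    \<comment> \<open>The Euclidean norm is at most the sum of the absolute components, each of
      which is at most \<open>M * ?tv \<nu>\<close>.\<close>
    have "norm ((LINT \<xi>|\<mu>. G \<xi> x) - (LINT \<xi>|\<mu>s \<nu>. G \<xi> x)) \<le> (real CARD('m) * M) * ?tv \<nu>" for \<nu>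
    proof -
      have "norm ((LINT \<xi>|\<mu>. G \<xi> x) - (LINT \<xi>|\<mu>s \<nu>. G \<xi> x))
          \<le> (\<Sum>i\<in>UNIV. \<bar>((LINT \<xi>|\<mu>. G \<xi> x) - (LINT \<xi>|\<mu>s \<nu>. G \<xi> x)) $ i\<bar>)"
        by (rule norm_le_l1_cart)
      also have "\<dots> \<le> (\<Sum>i\<in>(UNIV :: 'm set). M * ?tv \<nu>)"
      proof (rule sum_mono)
        fix i
        have "\<bar>(LINT \<xi>|\<mu>s \<nu>. G \<xi> x $ i) - (LINT \<xi>|\<mu>. G \<xi> x $ i)\<bar> \<le> M * ?tv \<nu>"
          by (rule abs_integral_diff_le_tv_dist[OF \<mu>s \<mu> meas M(2,1)])
        then show "\<bar>((LINT \<xi>|\<mu>. G \<xi> x) - (LINT \<xi>|\<mu>s \<nu>. G \<xi> x)) $ i\<bar> \<le> M * ?tv \<nu>"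
          by (simp add: comp[OF \<mu>] comp[OF \<mu>s] abs_minus_commute)
      qed
      finally show ?thesis by simp
    qed
    then show ?thesis
      using M(1) by (intro exI[of _ "real CARD('m) * M"]) auto
  qed

  \<comment> \<open>Epi-convergence\<close>
  have epi: "epi_converges fs f"
  proof (rule epi_converges_penalty[OF g0 h \<alpha> lam _ _ _ f fs])
    fix x xs i c assume "xs \<longlonglongrightarrow> x" "c < (LINT \<xi>|\<mu>. G \<xi> x) $ i"
    then show "\<forall>\<^sub>F \<nu> in sequentially. c < (LINT \<xi>|\<mu>s \<nu>. G \<xi> (xs \<nu>)) $ i"
      using integral_random_lsc_eventually_less_tv[OF \<mu> \<mu>s tv lsc bdd]
      by (simp add: comp[OF \<mu>] comp[OF \<mu>s])
  next
    fix x
    obtain K where K: "0 \<le> K"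
      "\<And>\<nu>. norm ((LINT \<xi>|\<mu>. G \<xi> x) - (LINT \<xi>|\<mu>s \<nu>. G \<xi> x)) \<le> K * ?tv \<nu>"
      using norm_le by blast
    have "(\<lambda>\<nu>. K * ?tv \<nu>) \<longlonglongrightarrow> 0"
      using tendsto_mult_left[OF tv, of K] by simp
    then have "(\<lambda>\<nu>. (LINT \<xi>|\<mu>. G \<xi> x) - (LINT \<xi>|\<mu>s \<nu>. G \<xi> x)) \<longlonglongrightarrow> 0"
      by (rule Lim_null_comparison[OF always_eventually, rotated]) (simp_all add: K(2))
    from tendsto_diff[OF tendsto_const this, of "LINT \<xi>|\<mu>. G \<xi> x"]
    show "(\<lambda>\<nu>. LINT \<xi>|\<mu>s \<nu>. G \<xi> x) \<longlonglongrightarrow> (LINT \<xi>|\<mu>. G \<xi> x)"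
      by simp
    \<comment> \<open>Raising the norm estimate to the power \<open>\<alpha>\<close> costs the
      factor \<open>K powr \<alpha>\<close>, constant in \<open>\<nu>\<close>.\<close>
    have rhs: "(\<lambda>\<nu>. K powr \<alpha> * (1 / lam \<nu> * ?tv \<nu> powr \<alpha>)) \<longlonglongrightarrow> 0"
      using tendsto_mult_left[OF rate, of "K powr \<alpha>"] by simp
    have "1 / lam \<nu> * norm ((LINT \<xi>|\<mu>. G \<xi> x) - (LINT \<xi>|\<mu>s \<nu>. G \<xi> x)) powr \<alpha>
        \<le> K powr \<alpha> * (1 / lam \<nu> * ?tv \<nu> powr \<alpha>)" for \<nu>
    proof -
      have "norm ((LINT \<xi>|\<mu>. G \<xi> x) - (LINT \<xi>|\<mu>s \<nu>. G \<xi> x)) powr \<alpha> \<le> (K * ?tv \<nu>) powr \<alpha>"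
        using K \<alpha> by (intro powr_mono2) auto
      also have "\<dots> = K powr \<alpha> * ?tv \<nu> powr \<alpha>"
        using K(1) tv_nonneg by (simp add: powr_mult)
      finally show ?thesis
        using lam(1)[of \<nu>] by (simp add: divide_simps)
    qed
    then have "norm (1 / lam \<nu> * norm ((LINT \<xi>|\<mu>. G \<xi> x) - (LINT \<xi>|\<mu>s \<nu>. G \<xi> x)) powr \<alpha>)
        \<le> K powr \<alpha> * (1 / lam \<nu> * ?tv \<nu> powr \<alpha>)" for \<nu>
      using lam(1)[of \<nu>] by simp
    then show "(\<lambda>\<nu>. 1 / lam \<nu> * norm ((LINT \<xi>|\<mu>. G \<xi> x) - (LINT \<xi>|\<mu>s \<nu>. G \<xi> x)) powr \<alpha>) \<longlonglongrightarrow> 0"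
      by (intro Lim_null_comparison[OF always_eventually rhs] allI)
  qed

  \<comment> \<open>Reduction of \<open>f\<close> to \<open>\<phi>\<close>\<close>
  have \<phi>_ne: "\<phi> x \<noteq> -\<infinity>" for x
    using g0(1) h(1) unfolding \<phi> proper_fun_def by simp
  \<comment> \<open>Neither \<open>g0\<close> nor \<open>h\<close> takes the value
    \<open>-\<infinity>\<close>, so an infinite indicator makes the whole sum infinite.\<close>
  have f_eq: "f (u, x) = (if u = 0 then \<phi> x else \<infinity>)" for u x
    using g0(1) h(1) unfolding f \<phi> proper_fun_def by (simp add: iota_def)
  have INF_eq: "(INF z. f z) = (INF x. \<phi> x)"
  proof (rule antisym)
    have "(INF z. f z) \<le> f (0, x)" for x by (rule INF_lower) simp
    then show "(INF z. f z) \<le> (INF x. \<phi> x)"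
      by (intro INF_greatest) (simp add: f_eq)
    have "(INF x. \<phi> x) \<le> f z" for z
      by (cases z) (simp add: f_eq INF_lower)
    then show "(INF x. \<phi> x) \<le> (INF z. f z)"
      by (intro INF_greatest)
  qed
  have eps: "eps_argmin \<epsilon> f = {0} \<times> eps_argmin \<epsilon> \<phi>" for \<epsilon>
    by (auto simp: eps_argmin_def dom_fun_def INF_eq f_eq split: if_splits)
  have argmin: "argmin_set f = {0} \<times> argmin_set \<phi>"
    using eps[of 0] unfolding eps_argmin_0 .
  with argmin_\<phi> have argmin_ne: "argmin_set f \<noteq> {}" by simp
  then obtain z0 where z0: "z0 \<in> argmin_set f" by blast
  \<comment> \<open>The infimum is the value of \<open>\<phi>\<close> at a minimizer, which is below
    \<open>\<infinity>\<close> and differs from \<open>-\<infinity>\<close>.\<close>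
  have fin: "\<bar>INF z. f z\<bar> \<noteq> \<infinity>"
  proof -
    obtain x where "\<phi> x < \<infinity>" "\<phi> x = (INF x. \<phi> x)"
      using argmin_\<phi> by (auto simp: argmin_set_def dom_fun_def)
    with \<phi>_ne[of x] show ?thesis by (metis INF_eq abs_eq_infinity_cases less_irrefl)
  qed
  then have fin': "(INF z. f z) < \<infinity>" by auto
  show ?thesis
  proof (intro conjI allI impI; (elim conjE)?)
    show "epi_converges fs f" "(INF z. f z) = (INF x. \<phi> x)" by fact+
    show "eps_argmin \<epsilon> f = {0} \<times> eps_argmin \<epsilon> \<phi>" for \<epsilon> by fact
    show "limsup (\<lambda>\<nu>. INF z. fs \<nu> z) \<le> (INF z. f z)"
      by (rule epi_converges_limsup_INF[OF epi])
    show "LimOut (\<lambda>\<nu>. eps_argmin (\<epsilon>s \<nu>) (fs \<nu>)) \<subseteq> eps_argmin \<epsilon> f" if "\<epsilon>s \<longlonglongrightarrow> \<epsilon>" for \<epsilon>s \<epsilon>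
      by (rule epi_converges_LimOut_eps_argmin[OF epi fin' that])
    show "((\<lambda>\<nu>. INF z. fs \<nu> z) \<longlongrightarrow> (INF z. f z)) (along N)"
      if "\<epsilon>s \<longlonglongrightarrow> 0" "\<forall>\<nu>\<in>N. (us \<nu>, xs \<nu>) \<in> eps_argmin (\<epsilon>s \<nu>) (fs \<nu>)"
        "\<exists>z. ((\<lambda>\<nu>. (us \<nu>, xs \<nu>)) \<longlongrightarrow> z) (along N)" for \<epsilon>s N us xs
      using that epi_converges_INF_tendsto_along[OF epi that(1), of N "\<lambda>\<nu>. (us \<nu>, xs \<nu>)"] by blast
    show "(\<lambda>\<nu>. INF z. fs \<nu> z) \<longlonglongrightarrow> (INF z. f z) \<longleftrightarrow> tight_funs fs"
      using epi_converges_tight_imp_INF_tendsto[OF epi]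
        epi_converges_INF_tendsto_imp_tight[OF epi fin z0] by blast
    assume lim: "(\<lambda>\<nu>. INF z. fs \<nu> z) \<longlonglongrightarrow> (INF z. f z)"
    show "\<forall>x0\<in>argmin_set \<phi>. \<exists>\<epsilon>s. (\<forall>\<nu>. 0 \<le> \<epsilon>s \<nu>) \<and> \<epsilon>s \<longlonglongrightarrow> 0 \<and>
            (0, x0) \<in> LimInn (\<lambda>\<nu>. eps_argmin (\<epsilon>s \<nu>) (fs \<nu>))"
      by (intro ballI epi_converges_argmin_LimInn[OF epi fin lim]) (simp add: argmin)
    show "\<exists>\<epsilon>s. (\<forall>\<nu>. 0 \<le> \<epsilon>s \<nu>) \<and> \<epsilon>s \<longlonglongrightarrow> 0 \<and>
            set_lim (\<lambda>\<nu>. eps_argmin (\<epsilon>s \<nu>) (fs \<nu>)) (argmin_set f)"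
      by (rule epi_converges_set_lim_argmin[OF epi fin lim argmin_ne])
  qed
qed

end
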